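(* For $f\in\mathcal{O}(\mathbb{R}^{m|2n})$ (with $m\ge1$) define the super basic spherical mean $Mf(\mathbf{x},L)=\int_{\mathbb{S}^{m-1|2n},\mathbf{y}}f(\mathbf{x}+L\mathbf{y})$. Then $\left[\nabla^2_{\mathbf{x}}-\frac{\partial^2}{\partial L^2}-\frac{M-1}{L}\frac{\partial}{\partial L}\right]Mf(\mathbf{x},L)=0$, where $M=m-2n$.
   Context: $\mathbb{R}^{m|2n}$ has even $x_1..x_m$ and odd $\grave{x}_1..\grave{x}_{2n}$; $\nabla^2=\sum_{i=1}^m\partial_{x_i}^2-4\sum_{j=1}^n\partial_{\grave{x}_{2j-1}}\partial_{\grave{x}_{2j}}$. $f(\mathbf{x}+L\mathbf{y})$ is the superfunction in $\mathbf{x}$, $\mathbf{y}$ (a second copy of coordinates) and $L$ obtained by finite Taylor expansion in the odd variables. The supersphere integral in $\mathbf{y}$ is, with $r,\theta^2$ in the $\mathbf{y}$-variables ($\theta^2=-\sum_k\grave{y}_{2k-1}\grave{y}_{2k}$), $\int_{\mathbb{S}^{m-1|2n}}g=\int_{\mathbb{S}^{m-1}}\int_B(1-\theta^2/r^2)^{\frac m2-1}\phi^\sharp g$, where $\phi^\sharp(g)=\sum_{j=0}^n\frac{(-1)^j\theta^{2j}}{j!}(\frac{1}{2r}\partial_r)^jg$, $\int_B=\pi^{-n}\partial_{\grave{y}_{2n}}\cdots\partial_{\grave{y}_1}$, and $\int_{\mathbb{S}^{m-1}}$ the standard unit sphere integral. *)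

theory Defs
  imports "HOL-Analysis.Analysis"
begin

text \<open>An element of the (real) Grassmann algebra is given by its coefficient function:
  a C is the coefficient of the monomial e_(c1) e_(c2) ... e_(ck) (c1 < c2 < ... < ck)
  for the finite set C = {c1,...,ck}.\<close>

type_synonym galg = "nat set \<Rightarrow> real"

definition gsign :: "nat set \<Rightarrow> nat set \<Rightarrow> real" where
  "gsign A B = (-1) ^ card {(i, j). i \<in> A \<and> j \<in> B \<and> j < i}"

definition gmul :: "galg \<Rightarrow> galg \<Rightarrow> galg" where
  "gmul a b = (\<lambda>C. if finite C then (\<Sum>A\<in>Pow C. gsign A (C - A) * a A * b (C - A)) else 0)"

definition gone :: galg where
  "gone = (\<lambda>C. if C = {} then 1 else 0)"

definition gzero :: galg where
  "gzero = (\<lambda>C. 0)"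

definition gen :: "nat \<Rightarrow> galg" where
  "gen k = (\<lambda>C. if C = {k} then 1 else 0)"

definition gadd :: "galg \<Rightarrow> galg \<Rightarrow> galg" where
  "gadd a b = (\<lambda>C. a C + b C)"

definition gscale :: "real \<Rightarrow> galg \<Rightarrow> galg" where
  "gscale c a = (\<lambda>C. c * a C)"

primrec gpow :: "galg \<Rightarrow> nat \<Rightarrow> galg" where
  "gpow a 0 = gone"
| "gpow a (Suc k) = gmul a (gpow a k)"

definition gderiv :: "nat \<Rightarrow> galg \<Rightarrow> galg" where
  "gderiv k a = (\<lambda>C. if k \<in> C then 0 else (-1) ^ card {i \<in> C. i < k} * a (insert k C))"

text \<open>Odd variables (0-indexed): the paper's x`_(i+1) is generator i (i < 2n);
  the paper's y`_(i+1) is generator 2n+i (i < 2n). Even variables x, y live in real^'m,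
  so m = CARD('m).\<close>

definition xodd :: "nat \<Rightarrow> nat \<Rightarrow> galg" where
  "xodd n i = gen i"

definition yodd :: "nat \<Rightarrow> nat \<Rightarrow> galg" where
  "yodd n i = gen (2 * n + i)"

definition smooth_fun :: "('a::euclidean_space \<Rightarrow> real) \<Rightarrow> bool" where
  "smooth_fun f \<longleftrightarrow> (\<exists>S. f \<in> S \<and> (\<forall>g\<in>S. \<exists>D. (\<forall>x. (g has_derivative D x) (at x))
        \<and> (\<forall>i\<in>Basis. (\<lambda>x. D x i) \<in> S)))"

text \<open>A superfunction f in O(R^{m|2n}): f(x) = sum over A subset {0..<2n} of f_A(x) x`^A,
  with smooth coefficients f_A; represented by the family of coefficients f A.\<close>
definition superfun :: "nat \<Rightarrow> (nat set \<Rightarrow> real^'m \<Rightarrow> real) \<Rightarrow> bool" where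
  "superfun n f \<longleftrightarrow> (\<forall>A. smooth_fun (f A)) \<and> (\<forall>A. \<not> A \<subseteq> {..<2*n} \<longrightarrow> (\<forall>x. f A x = 0))"

text \<open>f(x + L y) as a superfunction in x, x`, y, y`, L (finite Taylor expansion in the odd
  variables): sum_A f_A(x + L y) prod_(i in A, increasing) (x`_i + L y`_i).\<close>
definition oddprod :: "nat \<Rightarrow> real \<Rightarrow> nat set \<Rightarrow> galg" where
  "oddprod n L A = foldr (\<lambda>i acc. gmul (gadd (xodd n i) (gscale L (yodd n i))) acc)
                          (sorted_list_of_set A) gone"

definition shifted :: "nat \<Rightarrow> (nat set \<Rightarrow> real^'m \<Rightarrow> real) \<Rightarrow> real^'m \<Rightarrow> real \<Rightarrow> real^'m \<Rightarrow> galg" where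
  "shifted n f x L y = (\<lambda>C. \<Sum>A\<in>Pow {..<2*n}. f A (x + L *\<^sub>R y) * oddprod n L A C)"

definition theta2 :: "nat \<Rightarrow> galg" where
  "theta2 n = gscale (-1) (\<lambda>C. \<Sum>k<n. gmul (yodd n (2*k)) (yodd n (2*k+1)) C)"

definition radD :: "(real^'m \<Rightarrow> galg) \<Rightarrow> real^'m \<Rightarrow> galg" where
  "radD G y = (\<lambda>C. (1 / (2 * norm y)) * deriv (\<lambda>t. G (t *\<^sub>R (y /\<^sub>R norm y)) C) (norm y))"

definition phi_sharp :: "nat \<Rightarrow> (real^'m \<Rightarrow> galg) \<Rightarrow> real^'m \<Rightarrow> galg" where
  "phi_sharp n G y = (\<lambda>C. \<Sum>j\<le>n. ((-1) ^ j / fact j) * gmul (gpow (theta2 n) j) ((radD ^^ j) G y) C)"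

text \<open>(1 - theta^2/r^2)^(m/2-1), defined by the binomial series, which is finite because
  (theta^2)^k = 0 for k > n.\<close>
definition sphere_weight :: "nat \<Rightarrow> nat \<Rightarrow> real^'m \<Rightarrow> galg" where
  "sphere_weight m n y = (\<lambda>C. \<Sum>k\<le>n. ((real m / 2 - 1) gchoose k) * (-1) ^ k
                               * (1 / (norm y)\<^sup>2) ^ k * gpow (theta2 n) k C)"

primrec bz_iter :: "nat \<Rightarrow> nat \<Rightarrow> galg \<Rightarrow> galg" where
  "bz_iter n 0 a = a"
| "bz_iter n (Suc k) a = gderiv (2 * n + k) (bz_iter n k a)"

definition berezin :: "nat \<Rightarrow> galg \<Rightarrow> galg" where
  "berezin n a = gscale (1 / pi ^ n) (bz_iter n (2 * n) a)"

text \<open>Integral over the unit sphere S^(m-1) w.r.t. the standard surface measure,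
  for a (coefficientwise) Grassmann-valued function H, via
  int_(S^(m-1)) h d sigma = m * int_(unit ball) h(y/|y|) dy.\<close>
definition sphere_int :: "(real^'m \<Rightarrow> galg) \<Rightarrow> galg" where
  "sphere_int H = (\<lambda>C. real CARD('m) * integral (ball 0 1) (\<lambda>y. H (y /\<^sub>R norm y) C))"

definition supersphere_int :: "nat \<Rightarrow> (real^'m \<Rightarrow> galg) \<Rightarrow> galg" where
  "supersphere_int n G = sphere_int (\<lambda>\<omega>. berezin n (gmul (sphere_weight CARD('m) n \<omega>) (phi_sharp n G \<omega>)))"

definition spherical_mean :: "nat \<Rightarrow> (nat set \<Rightarrow> real^'m \<Rightarrow> real) \<Rightarrow> real^'m \<Rightarrow> real \<Rightarrow> galg" where
  "spherical_mean n f x L = supersphere_int n (shifted n f x L)"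

definition pderiv_x :: "real^'m \<Rightarrow> (real^'m \<Rightarrow> real) \<Rightarrow> real^'m \<Rightarrow> real" where
  "pderiv_x i g = (\<lambda>x. deriv (\<lambda>t. g (x + t *\<^sub>R i)) 0)"

definition super_laplace_x :: "nat \<Rightarrow> (real^'m \<Rightarrow> real \<Rightarrow> galg) \<Rightarrow> real^'m \<Rightarrow> real \<Rightarrow> galg" where
  "super_laplace_x n \<Phi> x L = (\<lambda>C.
      (\<Sum>i\<in>Basis. pderiv_x i (pderiv_x i (\<lambda>z. \<Phi> z L C)) x)
      - 4 * (\<Sum>j<n. gderiv (2*j) (gderiv (2*j+1) (\<Phi> x L)) C))"

definition darboux_op :: "nat \<Rightarrow> (real^'m \<Rightarrow> real \<Rightarrow> galg) \<Rightarrow> real^'m \<Rightarrow> real \<Rightarrow> galg" where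
  "darboux_op n \<Phi> x L = (\<lambda>C.
      super_laplace_x n \<Phi> x L C
      - deriv (deriv (\<lambda>l. \<Phi> x l C)) L
      - ((real CARD('m) - 2 * real n - 1) / L) * deriv (\<lambda>l. \<Phi> x l C) L)"

end

theory Submission
  imports Defs
begin

text \<open>Expanding f(x + L y) in the odd variables, the sphere weight and the Taylor operator combine by
  Leibniz' rule: on a monomial with coefficient h, the supersphere integral is
  \<Sum>_N (-1)^N/N! (d/ds)^N (s^a H(L^2 s)) at s = 1, times the Berezin integral of theta^(2N) against the odd part,
  where a = m/2 - 1 and H(s) is the integral of h (x + sqrt s w) over the unit sphere in w.
  By homogeneity of the Berezin integral, the L-dependence becomes (L^2)^(n-a) (d/ds)^N (s^a H(s))
  at s = L^2.
  The even Laplacian acts on H through the classical Darboux equation, a consequence of the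
  rotation invariance of the sphere; the odd Laplacian is moved from x` to y`, integrated by parts and
  evaluated on theta^(2N), which shifts N by one.  The remaining terms telescope in N.\<close>

section \<open>Integration over the unit sphere\<close>

text \<open>Let s = L^2 and D = d/ds; note M/2 = a + 1 - n. The radial operator d^2/dL^2 + ((M -
  1)/L) d/dL is 4(s D^2 + (M/2) D). In general s D^2 + c D maps s^(1 - c) v to s^(1 - c) (s D^2 + (2
  - c) D) v. For c = M/2 the power is s^(n - a), the very prefactor that homogeneity produces, and
  the radial operator becomes 4(s D^2 + (n + 1 - a) D) on v = D^N (s^a H). By the classical Darboux
  equation the even Laplacian is 4(s D^2 + (a + 1) D) on H, hence 4(s D^2 + (1 - a) D) on s^a H, and
  N derivatives turn 1 - a into N + 1 - a. The second order parts agree, and the difference is 4(N -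
  n) D, in which m no longer occurs. The odd Laplacian of the N-th Berezin coefficient is -4(N - 1 -
  n) times the preceding one, the same factor one step earlier with opposite sign. The term that
  survives the telescoping has N = n, where the factor is 0.\<close>

text \<open>Orthogonal maps send balls to balls of the same radius, and by Vitali's covering theorem an open
  set is a disjoint union of balls up to a null set.  The library's change of variables for linear maps
  is not applicable, as it asks for a well-ordered index type.\<close>

lemma emeasure_orthogonal_image_ge:
  fixes f :: "'a::euclidean_space \<Rightarrow> 'a"
  assumes f: "orthogonal_transformation f" and U: "open U"
  shows "emeasure lborel U \<le> emeasure lborel (f ` U)"
proof -
  define K where "K = {(c, r). 0 < r \<and> ball c r \<subseteq> U}"
  obtain C where C: "countable C" "C \<subseteq> K"
    and disj: "pairwise (\<lambda>i j. disjnt (ball (fst i) (snd i)) (ball (fst j) (snd j))) C"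
    and neg: "negligible (U - (\<Union>i\<in>C. ball (fst i) (snd i)))"
  proof (rule Vitali_covering_theorem_balls [of U K fst snd])
    fix x and d :: real
    assume "x \<in> U" "0 < d"
    then obtain e where "e > 0" "ball x e \<subseteq> U"
      using U openE by blast
    then show "\<exists>i. i \<in> K \<and> x \<in> ball (fst i) (snd i) \<and> snd i < d"
      using \<open>0 < d\<close> by (intro exI [of _ "(x, min e (d/2))"]) (auto simp: K_def)
  qed
  let ?B = "\<lambda>i. ball (fst i) (snd i)"
  have [simp]: "(\<Union>i\<in>C. ?B i) \<in> sets borel"
    by (intro borel_open open_UN) auto
  have sub: "?B i \<subseteq> U" and pos: "0 < snd i" if "i \<in> C" for i
    using that C(2) by (cases i; auto simp: K_def)+
  have inj: "inj f" and open_f: "\<And>V. open V \<Longrightarrow> open (f ` V)"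
    using f by (auto simp: orthogonal_transformation_inj orthogonal_transformation_surj
        orthogonal_transformation_linear intro: open_surjective_linear_image)
  have "emeasure lborel U \<le> emeasure lborel ((\<Union>i\<in>C. ?B i) \<union> (U - (\<Union>i\<in>C. ?B i)))"
    using U by (intro emeasure_mono) auto
  also have "\<dots> \<le> emeasure lborel (\<Union>i\<in>C. ?B i) + emeasure lborel (U - (\<Union>i\<in>C. ?B i))"
    using U by (intro emeasure_subadditive) auto
  also have "emeasure lborel (U - (\<Union>i\<in>C. ?B i)) = emeasure lebesgue (U - (\<Union>i\<in>C. ?B i))"
  proof -
    have "U - (\<Union>i\<in>C. ?B i) \<in> sets borel"
      using U by (intro sets.Diff) auto
    then show ?thesis by simp
  qed
  also have "\<dots> = 0"
    using neg unfolding negligible_iff_null_sets by (rule null_setsD1)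
  also have "emeasure lborel (\<Union>i\<in>C. ?B i) + 0 = emeasure lborel (\<Union>i\<in>C. ?B i)"
    by simp
  also have "\<dots> = (\<integral>\<^sup>+i. emeasure lborel (?B i) \<partial>count_space C)"
  proof (rule emeasure_UN_countable)
    show "disjoint_family_on ?B C"
      using disj unfolding disjoint_family_on_def pairwise_def disjnt_def by blast
  qed (use C(1) in auto)
  also have "\<dots> = (\<integral>\<^sup>+i. emeasure lborel (f ` ?B i) \<partial>count_space C)"
    by (intro nn_integral_cong)
      (auto simp: image_orthogonal_transformation_ball [OF f] emeasure_ball less_imp_le pos)
  also have "\<dots> = emeasure lborel (\<Union>i\<in>C. f ` ?B i)"
  proof (rule emeasure_UN_countable [symmetric])
    show "disjoint_family_on (\<lambda>i. f ` ?B i) C"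
      using disj unfolding disjoint_family_on_def pairwise_def disjnt_def image_Int [OF inj, symmetric]
      by blast
  qed (use C(1) open_f in auto)
  also have "\<dots> \<le> emeasure lborel (f ` U)"
    using sub open_f U by (intro emeasure_mono) auto
  finally show ?thesis .
qed

text \<open>One inequality suffices: it is applied to f on the preimage of a box and to
  \<open>inv f\<close> on the box itself, and boxes determine \<open>lborel\<close>.\<close>

lemma lborel_distr_orthogonal:
  fixes f :: "'a::euclidean_space \<Rightarrow> 'a"
  assumes f: "orthogonal_transformation f"
  shows "distr lborel borel f = lborel"
proof (rule lborel_eqI [symmetric])
  have cont: "continuous_on UNIV f"
    using f by (simp add: linear_continuous_on linear_conv_bounded_linear [symmetric] orthogonal_transformation_linear)
  fix l u :: 'a
  assume le: "\<And>b. b \<in> Basis \<Longrightarrow> l \<bullet> b \<le> u \<bullet> b"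
  have img: "f ` (f -` box l u) = box l u"
    using orthogonal_transformation_surj [OF f] by (simp add: surj_image_vimage_eq)
  have pre: "f -` box l u = inv f ` box l u"
    using orthogonal_transformation_bij [OF f] by (simp add: bij_vimage_eq_inv_image)
  have op: "open (f -` box l u)"
    using cont by (rule open_vimage [OF open_box])
  have "emeasure lborel (f -` box l u) \<le> emeasure lborel (box l u)"
    using emeasure_orthogonal_image_ge [OF f op] img by simp
  moreover have "emeasure lborel (box l u) \<le> emeasure lborel (f -` box l u)"
    unfolding pre using f by (intro emeasure_orthogonal_image_ge orthogonal_transformation_inv) auto
  ultimately have "emeasure lborel (f -` box l u) = emeasure lborel (box l u)"
    by simp
  then show "emeasure (distr lborel borel f) (box l u) = (\<Prod>b\<in>Basis. (u - l) \<bullet> b)"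
    using cont le by (subst emeasure_distr) (auto simp: borel_measurable_continuous_onI)
qed simp

section \<open>The sphere integral of a scalar function\<close>

definition surface_int :: "(real^'m \<Rightarrow> real) \<Rightarrow> real" where
  "surface_int u = real CARD('m) * integral (ball 0 1) (\<lambda>y. u (y /\<^sub>R norm y))"

text \<open>The radial projection sends the origin to 0, which is not a unit vector, but a single
  point is negligible.\<close>

lemma surface_int_cong:
  assumes "\<And>w. norm w = 1 \<Longrightarrow> u w = v w"
  shows "surface_int u = surface_int v"
proof -
  have "integral (ball 0 1) (\<lambda>y. u (y /\<^sub>R norm y)) = integral (ball 0 1) (\<lambda>y. v (y /\<^sub>R norm y))"
    by (rule integral_spike [of "{0}"]) (auto simp: assms)
  then show ?thesis by (simp add: surface_int_def)
qed

text \<open>Compactness of the sphere bounds u. The origin is cut out because the radial projection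
  is continuous only away from it.\<close>

lemma integrable_surface_int:
  fixes u :: "real^'m \<Rightarrow> real"
  assumes "continuous_on (sphere 0 1) u"
  shows "(\<lambda>y. u (y /\<^sub>R norm y)) absolutely_integrable_on ball 0 1"
proof -
  let ?B = "ball (0::real^'m) 1" and ?g = "\<lambda>y. u (y /\<^sub>R norm y)"
  obtain B where B: "\<And>w. w \<in> sphere 0 1 \<Longrightarrow> \<bar>u w\<bar> \<le> B"
    using compact_imp_bounded [OF compact_continuous_image [OF assms compact_sphere]]
    unfolding bounded_iff by (metis image_eqI real_norm_def)
  have "?g absolutely_integrable_on (?B - {0})"
  proof (rule measurable_bounded_by_integrable_imp_absolutely_integrable)
    show "?g \<in> borel_measurable (lebesgue_on (?B - {0}))"
    proof (rule continuous_imp_measurable_on_sets_lebesgue)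
      show "continuous_on (?B - {0}) ?g"
        by (rule continuous_on_compose2 [OF assms]) (auto intro!: continuous_intros left_inverse)
    qed auto
    show "(\<lambda>y. B) integrable_on ?B - {0}"
      by (intro integrable_on_const bounded_set_imp_lmeasurable) (auto intro: bounded_subset [OF bounded_ball])
    show "norm (?g y) \<le> B" if "y \<in> ?B - {0}" for y
      using that by (auto intro!: B)
  qed auto
  then show ?thesis
    by (rule absolutely_integrable_spike_set) (auto intro: negligible_subset [of "{0}"])
qed

text \<open>Moves the gauge integral to \<open>lborel\<close>, where invariance under a map is a
  statement about \<open>distr\<close>. The indicator makes the integrand a Borel function on the
  whole space although u is controlled on the sphere only.\<close>

lemma surface_int_eq_lborel:
  fixes u :: "real^'m \<Rightarrow> real"
  assumes u: "continuous_on (sphere 0 1) u"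
  shows "(\<lambda>y. indicat_real (ball 0 1 - {0}) y * u (y /\<^sub>R norm y)) \<in> borel_measurable borel" (is ?m)
    and "surface_int u = real CARD('m) * (\<integral>y. indicat_real (ball 0 1 - {0}) y * u (y /\<^sub>R norm y) \<partial>lborel)" (is ?i)
proof -
  define k where "k = (\<lambda>y. indicat_real (ball 0 1 - {0}) y * u (y /\<^sub>R norm y))"
  have "continuous_on (ball 0 1 - {0}) (\<lambda>y. u (y /\<^sub>R norm y))"
    by (rule continuous_on_compose2 [OF u]) (auto intro!: continuous_intros left_inverse)
  then have "(\<lambda>y. indicat_real (ball 0 1 - {0}) y *\<^sub>R u (y /\<^sub>R norm y)) \<in> borel_measurable borel"
    by (intro borel_measurable_continuous_on_indicator) auto
  then have meas: "k \<in> borel_measurable borel"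
    by (simp add: k_def)
  then show ?m
    by (simp add: k_def)
  have "(\<lambda>y. u (y /\<^sub>R norm y)) absolutely_integrable_on (ball 0 1 - {0})"
    by (rule absolutely_integrable_spike_set [OF integrable_surface_int [OF u]])
      (auto intro: negligible_subset [of "{0}"])
  then have "integrable lebesgue k"
    by (simp add: set_integrable_def k_def)
  then have int: "integrable lborel k"
    using meas by (simp add: integrable_completion)
  have "integral (ball 0 1) (\<lambda>y. u (y /\<^sub>R norm y)) = integral (ball 0 1) k"
    by (rule integral_spike [of "{0}"]) (auto simp: k_def)
  also have "\<dots> = integral UNIV (\<lambda>y. if y \<in> ball 0 1 then k y else 0)"
    by (rule integral_restrict_UNIV [symmetric])
  also have "(\<lambda>y. if y \<in> ball 0 1 then k y else 0) = k"
    by (auto simp: k_def fun_eq_iff)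
  also have "integral UNIV k = (\<integral>y. k y \<partial>lborel)"
    using int by (rule integral_lborel)
  finally show ?i
    by (simp add: surface_int_def k_def)
qed

text \<open>An orthogonal map commutes with the radial projection and preserves the punctured ball,
  so the invariance of Lebesgue measure passes to the sphere.\<close>

lemma surface_int_orthogonal:
  fixes u :: "real^'m \<Rightarrow> real" and f :: "real^'m \<Rightarrow> real^'m"
  assumes f: "orthogonal_transformation f" and u: "continuous_on (sphere 0 1) u"
  shows "surface_int (\<lambda>w. u (f w)) = surface_int u"
proof -
  let ?k = "\<lambda>y. indicat_real (ball 0 1 - {0}) y * u (y /\<^sub>R norm y)"
  have lin: "linear f" and nrm: "norm (f y) = norm y" for y
    using f by (auto simp: orthogonal_transformation)
  have cont: "continuous_on S f" for S
    using lin by (simp add: linear_continuous_on linear_conv_bounded_linear [symmetric])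
  have "continuous_on (sphere 0 1) (\<lambda>w. u (f w))"
    by (rule continuous_on_compose2 [OF u cont]) (auto simp: nrm)
  then have "surface_int (\<lambda>w. u (f w)) = real CARD('m) *
      (\<integral>y. indicat_real (ball 0 1 - {0}) y * u (f (y /\<^sub>R norm y)) \<partial>lborel)"
    using surface_int_eq_lborel(2) [of "\<lambda>w. u (f w)"] by simp
  also have "(\<lambda>y. indicat_real (ball 0 1 - {0}) y * u (f (y /\<^sub>R norm y))) = (\<lambda>y. ?k (f y))"
  proof
    show "indicat_real (ball 0 1 - {0}) y * u (f (y /\<^sub>R norm y)) = ?k (f y)" for y
      using nrm [of y] linear_cmul [OF lin, of "inverse (norm y)" y] norm_eq_zero [of y] norm_eq_zero [of "f y"]
      by (auto simp: indicator_def)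
  qed
  also have "(\<integral>y. ?k (f y) \<partial>lborel) = (\<integral>y. ?k y \<partial>distr lborel borel f)"
    using surface_int_eq_lborel(1) [OF u] borel_measurable_continuous_onI [OF cont]
    by (subst integral_distr) auto
  also have "\<dots> = (\<integral>y. ?k y \<partial>lborel)"
    by (simp add: lborel_distr_orthogonal [OF f])
  finally show ?thesis
    by (simp add: surface_int_eq_lborel(2) [OF u])
qed

lemma surface_int_cmult: "surface_int (\<lambda>w. c * u w) = c * surface_int u"
  by (simp add: surface_int_def)

lemma surface_int_add:
  assumes "continuous_on (sphere 0 1) u" "continuous_on (sphere 0 1) v"
  shows "surface_int (\<lambda>w. u w + v w) = surface_int u + surface_int v"
  using integrable_surface_int [OF assms(1)] integrable_surface_int [OF assms(2)]
  by (simp add: surface_int_def set_lebesgue_integral_eq_integral(1) integral_add ring_distribs)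

lemma surface_int_diff:
  assumes "continuous_on (sphere 0 1) u" "continuous_on (sphere 0 1) v"
  shows "surface_int (\<lambda>w. u w - v w) = surface_int u - surface_int v"
  using surface_int_add [OF assms(1) continuous_on_minus [OF assms(2)]] surface_int_cmult [of "-1" v] by simp

lemma surface_int_sum:
  assumes "finite I" "\<And>i. i \<in> I \<Longrightarrow> continuous_on (sphere 0 1) (u i)"
  shows "surface_int (\<lambda>w. \<Sum>i\<in>I. u i w) = (\<Sum>i\<in>I. surface_int (u i))"
  using assms
proof (induction I)
  case empty
  then show ?case by (simp add: surface_int_def)
next
  case (insert i I)
  then show ?case
    by (simp add: surface_int_add continuous_on_sum)
qed

lemma abs_surface_int_le:
  fixes u :: "real^'m \<Rightarrow> real"
  assumes "continuous_on (sphere 0 1) u" "\<And>w. norm w = 1 \<Longrightarrow> \<bar>u w\<bar> \<le> B"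
  shows "\<bar>surface_int u\<bar> \<le> B * surface_int (\<lambda>w::real^'m. 1)"
proof -
  have "norm (integral (ball 0 1 - {0}) (\<lambda>y::real^'m. u (y /\<^sub>R norm y))) \<le> integral (ball 0 1 - {0}) (\<lambda>y::real^'m. B)"
  proof (rule Henstock_Kurzweil_Integration.integral_norm_bound_integral)
    have "(\<lambda>y. u (y /\<^sub>R norm y)) absolutely_integrable_on (ball 0 1 - {0})"
      by (rule absolutely_integrable_spike_set [OF integrable_surface_int [OF assms(1)]])
        (auto intro: negligible_subset [of "{0}"])
    then show "(\<lambda>y. u (y /\<^sub>R norm y)) integrable_on (ball 0 1 - {0})"
      by (rule set_lebesgue_integral_eq_integral(1))
    show "(\<lambda>y::real^'m. B) integrable_on ball 0 1 - {0}"
      by (intro integrable_on_const bounded_set_imp_lmeasurable) (auto intro: bounded_subset [OF bounded_ball])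
  qed (use assms(2) in auto)
  moreover have "integral (ball 0 1 - {0}) g = integral (ball 0 1) g" for g :: "real^'m \<Rightarrow> real"
    by (rule integral_spike_set) (auto intro: negligible_subset [of "{0}"])
  moreover have "integral (ball 0 1) (\<lambda>y::real^'m. B) = B * integral (ball 0 1) (\<lambda>y::real^'m. 1)"
    using integral_mult_right [of "ball 0 1" B "\<lambda>y::real^'m. 1"] by simp
  ultimately have "\<bar>integral (ball 0 1) (\<lambda>y::real^'m. u (y /\<^sub>R norm y))\<bar> \<le> B * integral (ball 0 1) (\<lambda>y::real^'m. 1)"
    by simp
  then show ?thesis
    by (simp add: surface_int_def abs_mult mult.left_commute)
qed

text \<open>Differentiation under the integral sign. \<open>F'\<close> is uniformly continuous on
  the product of a compact interval and the sphere, so by the mean value theorem the difference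
  quotients converge uniformly in w.\<close>

lemma surface_int_has_real_derivative:
  fixes F F' :: "real \<Rightarrow> real^'m \<Rightarrow> real"
  assumes S: "open S" "s0 \<in> S"
    and der: "\<And>s w. s \<in> S \<Longrightarrow> norm w = 1 \<Longrightarrow> ((\<lambda>s. F s w) has_real_derivative F' s w) (at s)"
    and cont: "\<And>s. s \<in> S \<Longrightarrow> continuous_on (sphere 0 1) (F s)"
    and cont': "continuous_on (S \<times> sphere 0 1) (\<lambda>(s, w). F' s w)"
  shows "((\<lambda>s. surface_int (F s)) has_real_derivative surface_int (F' s0)) (at s0)"
proof -
  obtain r where r: "r > 0" "cball s0 r \<subseteq> S"
    using S open_contains_cball by blast
  let ?V = "surface_int (\<lambda>w::real^'m. 1)"
  have V: "0 \<le> ?V"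
    using abs_surface_int_le [of "\<lambda>w::real^'m. 1" 1] by simp
  have contF': "continuous_on (sphere 0 1) (F' s)" if "s \<in> S" for s
    using continuous_on_compose2 [OF cont' continuous_on_Pair [OF continuous_on_const continuous_on_id],
        of s "sphere 0 1"] that by auto
  have "uniformly_continuous_on (cball s0 r \<times> sphere 0 1) (\<lambda>(s, w). F' s w)"
    using r by (intro compact_uniformly_continuous continuous_on_subset [OF cont'] compact_Times) auto
  note uc = this [unfolded uniformly_continuous_on_def, rule_format]
  show ?thesis
    unfolding has_field_derivative_def has_derivative_at_alt
  proof (intro conjI allI impI)
    show "bounded_linear ((*) (surface_int (F' s0)))"
      by (rule bounded_linear_mult_right)
    fix e :: real
    assume "e > 0"
    \<comment> \<open>The divisor is \<open>?V + 1\<close> because only nonnegativity of the total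
      mass \<open>?V\<close> is at hand.\<close>
    define e' where "e' = e / (?V + 1)"
    have e': "e' > 0" "e' * ?V \<le> e"
      using \<open>e > 0\<close> V by (auto simp: e'_def field_simps)
    obtain d where d: "d > 0" and
      dd: "\<And>p q. p \<in> cball s0 r \<times> sphere 0 1 \<Longrightarrow> q \<in> cball s0 r \<times> sphere 0 1 \<Longrightarrow> dist q p < d \<Longrightarrow>
          dist ((\<lambda>(s, w). F' s w) q) ((\<lambda>(s, w). F' s w) p) < e'"
      using uc [OF e'(1)] by blast
    show "\<exists>d>0. \<forall>s. norm (s - s0) < d \<longrightarrow>
        norm (surface_int (F s) - surface_int (F s0) - surface_int (F' s0) * (s - s0)) \<le> e * norm (s - s0)"
    proof (intro exI [of _ "min d r"] conjI allI impI)
      fix s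
      assume s: "norm (s - s0) < min d r"
      then have sS: "s \<in> S"
        using r by (auto simp: dist_real_def)
      have "\<bar>F s w - F s0 w - (s - s0) * F' s0 w\<bar> \<le> e' * \<bar>s - s0\<bar>" if w: "norm w = 1" for w
      proof -
        have "\<exists>x\<in>closed_segment s0 s. F s w - F s0 w = (s - s0) * F' x w"
        proof -
          have der': "((\<lambda>s. F s w) has_real_derivative F' x w) (at x)" if "x \<in> closed_segment s0 s" for x
          proof (rule der [OF _ w])
            have "dist s0 x \<le> r"
              using that s by (auto simp: closed_segment_eq_real_ivl dist_real_def split: if_splits)
            then show "x \<in> S" using r by auto
          qed
          consider "s0 < s" | "s = s0" | "s < s0" by linarith
          then show ?thesis
          proof cases
            case 1
            then have "\<exists>x. s0 < x \<and> x < s \<and> F s w - F s0 w = (s - s0) * F' x w"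
              using der' by (intro MVT2) (auto simp: closed_segment_eq_real_ivl)
            with 1 show ?thesis by (auto simp: closed_segment_eq_real_ivl)
          next
            case 3
            then have "\<exists>x. s < x \<and> x < s0 \<and> F s0 w - F s w = (s0 - s) * F' x w"
              using der' by (intro MVT2) (auto simp: closed_segment_eq_real_ivl)
            then obtain x where "s < x" "x < s0" "F s0 w - F s w = (s0 - s) * F' x w" by blast
            with 3 show ?thesis
              by (intro bexI [of _ x]) (auto simp: closed_segment_eq_real_ivl algebra_simps)
          qed auto
        qed
        then obtain x where x: "x \<in> closed_segment s0 s" "F s w - F s0 w = (s - s0) * F' x w"
          by blast
        have xd: "\<bar>x - s0\<bar> \<le> \<bar>s - s0\<bar>"
          using x(1) by (auto simp: closed_segment_eq_real_ivl split: if_splits)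
        have "\<bar>F' x w - F' s0 w\<bar> < e'"
          using dd [of "(s0, w)" "(x, w)"] xd s w r by (auto simp: dist_Pair_Pair dist_real_def)
        then have "\<bar>s - s0\<bar> * \<bar>F' x w - F' s0 w\<bar> \<le> \<bar>s - s0\<bar> * e'"
          by (intro mult_left_mono) auto
        then show ?thesis
          unfolding x(2) right_diff_distrib [symmetric] abs_mult by (simp only: mult.commute)
      qed
      then have "\<bar>surface_int (\<lambda>w. F s w - F s0 w - (s - s0) * F' s0 w)\<bar> \<le> e' * \<bar>s - s0\<bar> * ?V"
        using sS S(2) by (intro abs_surface_int_le) (auto intro!: continuous_intros cont contF')
      also have "\<dots> \<le> e * \<bar>s - s0\<bar>"
        using mult_right_mono [OF e'(2), of "\<bar>s - s0\<bar>"] by (simp add: ac_simps)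
      also have "surface_int (\<lambda>w. F s w - F s0 w - (s - s0) * F' s0 w) = surface_int (F s) - surface_int (F s0) - surface_int (F' s0) * (s - s0)"
        using sS S(2) by (simp add: surface_int_diff surface_int_cmult cont contF' continuous_on_diff continuous_on_mult_left)
      finally show "norm (surface_int (F s) - surface_int (F s0) - surface_int (F' s0) * (s - s0)) \<le> e * norm (s - s0)"
        by simp
    qed (use d r in auto)
  qed
qed

section \<open>Radial derivatives\<close>

text \<open>\<open>smooth_fun\<close> provides derivatives only existentially; the Frechet
  derivative makes the partial derivative a function of i and h.\<close>

definition partial_deriv :: "'a::euclidean_space \<Rightarrow> ('a \<Rightarrow> real) \<Rightarrow> 'a \<Rightarrow> real" where
  "partial_deriv i h x = frechet_derivative h (at x) i"

text \<open>The set S that witnesses smoothness of h contains its partial derivatives and so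
  witnesses their smoothness too. Uniqueness of the Frechet derivative identifies the witness D with
  \<open>partial_deriv\<close>.\<close>

lemma smooth_funD:
  assumes "smooth_fun h"
  shows smooth_fun_partial: "i \<in> Basis \<Longrightarrow> smooth_fun (partial_deriv i h)"
    and smooth_fun_has_derivative: "(h has_derivative (\<lambda>v. \<Sum>i\<in>Basis. (v \<bullet> i) * partial_deriv i h x)) (at x)"
proof -
  obtain S D where S: "h \<in> S" "\<And>g. g \<in> S \<Longrightarrow> \<exists>D. (\<forall>x. (g has_derivative D x) (at x))
        \<and> (\<forall>i\<in>Basis. (\<lambda>x. D x i) \<in> S)"
    and D: "\<And>x. (h has_derivative D x) (at x)" "\<And>i. i \<in> Basis \<Longrightarrow> (\<lambda>x. D x i) \<in> S"
    using assms unfolding smooth_fun_def by metis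
  have partial_deriv: "partial_deriv i h = (\<lambda>x. D x i)" for i
    using frechet_derivative_at [OF D(1)] by (simp add: partial_deriv_def fun_eq_iff)
  show "smooth_fun (partial_deriv i h)" if "i \<in> Basis"
    unfolding smooth_fun_def partial_deriv using S(2) D(2) [OF that] by blast
  have "D x v = (\<Sum>i\<in>Basis. (v \<bullet> i) * partial_deriv i h x)" for v
  proof -
    have lin: "linear (D x)"
      using D(1) by (rule has_derivative_linear)
    have "D x (\<Sum>i\<in>Basis. (v \<bullet> i) *\<^sub>R i) = (\<Sum>i\<in>Basis. (v \<bullet> i) *\<^sub>R D x i)"
      by (simp add: linear_sum [OF lin] linear_cmul [OF lin])
    then show ?thesis
      by (simp add: euclidean_representation partial_deriv)
  qed
  then show "(h has_derivative (\<lambda>v. \<Sum>i\<in>Basis. (v \<bullet> i) * partial_deriv i h x)) (at x)"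
    by (intro has_derivative_eq_rhs [OF D(1) [of x]]) auto
qed

lemma smooth_fun_continuous_on: "smooth_fun h \<Longrightarrow> continuous_on S h"
  by (intro continuous_at_imp_continuous_on ballI has_derivative_continuous [OF smooth_fun_has_derivative])

lemma smooth_fun_DERIV_line:
  assumes "smooth_fun h"
  shows "((\<lambda>t. h (x + t *\<^sub>R w)) has_real_derivative (\<Sum>i\<in>Basis. (w \<bullet> i) * partial_deriv i h (x + t *\<^sub>R w))) (at t)"
proof -
  have "((\<lambda>t. x + t *\<^sub>R w) has_derivative (\<lambda>s. s *\<^sub>R w)) (at t)"
    by (auto intro!: derivative_eq_intros)
  from has_derivative_compose [OF this smooth_fun_has_derivative [OF assms]] show ?thesis
    unfolding has_field_derivative_def
    by (rule has_derivative_eq_rhs) (simp add: fun_eq_iff sum_distrib_left mult.assoc mult.commute)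
qed

text \<open>A class of functions of the centre x, the radius t and the direction w, regular for t \<noteq> 0 and
  closed under differentiation in t and in x; values at t = 0 are junk (1 / 0 = 0) and are ignored.\<close>

inductive_set radial_funs :: "(real^'m \<Rightarrow> real \<Rightarrow> real^'m \<Rightarrow> real) set" where
  smooth: "smooth_fun h \<Longrightarrow> (\<lambda>x t w. h (x + t *\<^sub>R w)) \<in> radial_funs"
| inner: "(\<lambda>x t w. w \<bullet> i) \<in> radial_funs"
| const: "(\<lambda>x t w. c) \<in> radial_funs"
| inverse: "(\<lambda>x t w. 1 / t) \<in> radial_funs"
| add: "F \<in> radial_funs \<Longrightarrow> G \<in> radial_funs \<Longrightarrow> (\<lambda>x t w. F x t w + G x t w) \<in> radial_funs"
| mult: "F \<in> radial_funs \<Longrightarrow> G \<in> radial_funs \<Longrightarrow> (\<lambda>x t w. F x t w * G x t w) \<in> radial_funs"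
| cong: "F \<in> radial_funs \<Longrightarrow> (\<And>x t w. t \<noteq> 0 \<Longrightarrow> G x t w = F x t w) \<Longrightarrow> G \<in> radial_funs"

lemma radial_funs_sum:
  assumes "finite I" "\<And>i. i \<in> I \<Longrightarrow> F i \<in> radial_funs"
  shows "(\<lambda>x t w. \<Sum>i\<in>I. F i x t w) \<in> radial_funs"
  using assms by (induction I) (auto intro: radial_funs.const radial_funs.add)

text \<open>Differentiation at a nonzero point is local, so an identity known only off 0, such as
  one that divides by t, may be differentiated there.\<close>

lemma has_real_derivative_cong_off_zero:
  assumes "(f has_real_derivative D) (at t)" "t \<noteq> 0" "\<And>t. t \<noteq> 0 \<Longrightarrow> g t = f t"
  shows "(g has_real_derivative D) (at t)"
  by (rule has_field_derivative_transform_within_open [OF assms(1), of "- {0}"]) (use assms in auto)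

lemma radial_funs_deriv_t:
  assumes "F \<in> radial_funs"
  shows "\<exists>F'\<in>radial_funs. \<forall>x t w. t \<noteq> 0 \<longrightarrow> ((\<lambda>t. F x t w) has_real_derivative F' x t w) (at t)"
  using assms
proof induction
  case (smooth h)
  have "(\<lambda>x t w. \<Sum>i\<in>Basis. (w \<bullet> i) * partial_deriv i h (x + t *\<^sub>R w)) \<in> radial_funs"
    using smooth by (intro radial_funs_sum radial_funs.mult radial_funs.inner radial_funs.smooth smooth_fun_partial) auto
  then show ?case
    by (rule bexI [rotated]) (use smooth_fun_DERIV_line [OF smooth] in auto)
next
  case (inner i)
  show ?case by (rule bexI [OF _ radial_funs.const [of 0]]) auto
next
  case (const c)
  show ?case by (rule bexI [OF _ radial_funs.const [of 0]]) auto
next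
  case inverse
  have "(\<lambda>x t w. -1 * (1 / t * (1 / t))) \<in> radial_funs"
    by (intro radial_funs.mult radial_funs.const radial_funs.inverse)
  then show ?case
    by (rule bexI [rotated]) (auto intro!: derivative_eq_intros)
next
  case (add F G)
  then obtain F' G' where *: "F' \<in> radial_funs" "G' \<in> radial_funs"
    "\<And>x t w. t \<noteq> 0 \<Longrightarrow> ((\<lambda>t. F x t w) has_real_derivative F' x t w) (at t)"
    "\<And>x t w. t \<noteq> 0 \<Longrightarrow> ((\<lambda>t. G x t w) has_real_derivative G' x t w) (at t)"
    by blast
  show ?case
    by (rule bexI [OF _ radial_funs.add [OF *(1,2)]]) (auto intro!: derivative_eq_intros *)
next
  case (mult F G)
  then obtain F' G' where *: "F' \<in> radial_funs" "G' \<in> radial_funs"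
    "\<And>x t w. t \<noteq> 0 \<Longrightarrow> ((\<lambda>t. F x t w) has_real_derivative F' x t w) (at t)"
    "\<And>x t w. t \<noteq> 0 \<Longrightarrow> ((\<lambda>t. G x t w) has_real_derivative G' x t w) (at t)"
    by blast
  show ?case
    by (rule bexI [OF _ radial_funs.add [OF radial_funs.mult [OF *(1) mult(2)] radial_funs.mult [OF mult(1) *(2)]]])
      (auto intro!: derivative_eq_intros *)
next
  case (cong F G)
  then obtain F' where *: "F' \<in> radial_funs"
    "\<And>x t w. t \<noteq> 0 \<Longrightarrow> ((\<lambda>t. F x t w) has_real_derivative F' x t w) (at t)"
    by blast
  show ?case
    by (intro bexI [OF _ *(1)] allI impI, rule has_real_derivative_cong_off_zero [OF *(2)])
      (use cong.hyps in auto)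
qed

lemma radial_funs_deriv_x:
  assumes "F \<in> radial_funs" and i: "i \<in> Basis"
  shows "\<exists>F'\<in>radial_funs. \<forall>x t w s. t \<noteq> 0 \<longrightarrow>
    ((\<lambda>s. F (x + s *\<^sub>R i) t w) has_real_derivative F' (x + s *\<^sub>R i) t w) (at s)"
  using assms(1)
proof induction
  case (smooth h)
  have "(\<lambda>x t w. partial_deriv i h (x + t *\<^sub>R w)) \<in> radial_funs"
    using smooth i by (intro radial_funs.smooth smooth_fun_partial)
  moreover have "((\<lambda>s. h (x + s *\<^sub>R i + t *\<^sub>R w)) has_real_derivative partial_deriv i h (x + s *\<^sub>R i + t *\<^sub>R w)) (at s)" for x s t w
    using smooth_fun_DERIV_line [OF smooth, of "x + t *\<^sub>R w" i s] i
    by (simp add: inner_Basis if_distrib [where f = "\<lambda>z. z * _"] sum.delta add_ac cong: if_cong)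
  ultimately show ?case
    by (intro bexI [of _ "\<lambda>x t w. partial_deriv i h (x + t *\<^sub>R w)"] allI impI)
next
  case (add F G)
  then obtain F' G' where *: "F' \<in> radial_funs" "G' \<in> radial_funs"
    "\<And>x t w s. t \<noteq> 0 \<Longrightarrow> ((\<lambda>s. F (x + s *\<^sub>R i) t w) has_real_derivative F' (x + s *\<^sub>R i) t w) (at s)"
    "\<And>x t w s. t \<noteq> 0 \<Longrightarrow> ((\<lambda>s. G (x + s *\<^sub>R i) t w) has_real_derivative G' (x + s *\<^sub>R i) t w) (at s)"
    by blast
  show ?case
    by (rule bexI [OF _ radial_funs.add [OF *(1,2)]]) (auto intro!: derivative_eq_intros *)
next
  case (mult F G)
  then obtain F' G' where *: "F' \<in> radial_funs" "G' \<in> radial_funs"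
    "\<And>x t w s. t \<noteq> 0 \<Longrightarrow> ((\<lambda>s. F (x + s *\<^sub>R i) t w) has_real_derivative F' (x + s *\<^sub>R i) t w) (at s)"
    "\<And>x t w s. t \<noteq> 0 \<Longrightarrow> ((\<lambda>s. G (x + s *\<^sub>R i) t w) has_real_derivative G' (x + s *\<^sub>R i) t w) (at s)"
    by blast
  show ?case
    by (rule bexI [OF _ radial_funs.add [OF radial_funs.mult [OF *(1) mult(2)] radial_funs.mult [OF mult(1) *(2)]]])
      (auto intro!: derivative_eq_intros *)
next
  case (cong F G)
  then show ?case by simp
qed (rule bexI [OF _ radial_funs.const [of 0]], simp)+

lemma radial_funs_continuous_on:
  assumes "F \<in> radial_funs"
  shows "continuous_on (UNIV \<times> (- {0}) \<times> UNIV) (\<lambda>(x, t, w). F x t w)"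
  using assms
proof induction
  case (smooth h)
  show ?case
    unfolding case_prod_unfold
    by (rule continuous_on_compose2 [OF smooth_fun_continuous_on [OF smooth, of UNIV]]) (auto intro!: continuous_intros)
next
  case (cong F G)
  have "continuous_on (UNIV \<times> (- {0}) \<times> UNIV) (\<lambda>(x, t, w). G x t w) \<longleftrightarrow>
        continuous_on (UNIV \<times> (- {0}) \<times> UNIV) (\<lambda>(x, t, w). F x t w)"
    by (rule continuous_on_cong) (auto intro!: cong.hyps(2))
  with cong show ?case by simp
qed (auto simp: case_prod_unfold intro!: continuous_intros)

lemma radial_funs_continuous_on_compose:
  assumes "F \<in> radial_funs" "continuous_on S a" "continuous_on S b" "continuous_on S c" "\<And>p. p \<in> S \<Longrightarrow> b p \<noteq> 0"
  shows "continuous_on S (\<lambda>p. F (a p) (b p) (c p))"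
  using continuous_on_compose2 [OF radial_funs_continuous_on [OF assms(1)], of S "\<lambda>p. (a p, b p, c p)"] assms(2-)
  by (simp add: image_subset_iff continuous_on_Pair)

text \<open>Only one order of differentiation is assumed to exist. The other comes from writing F as
  the integral of \<open>Ft\<close> from a fixed a to t, differentiating in s under the integral,
  and applying the fundamental theorem of calculus in t.\<close>

lemma mixed_partials_commute:
  fixes F Fs Ft Fst :: "real \<Rightarrow> real \<Rightarrow> real"
  assumes T: "open T" "t0 \<in> T"
    and Fs: "\<And>s t. t \<in> T \<Longrightarrow> ((\<lambda>s. F s t) has_real_derivative Fs s t) (at s)"
    and Ft: "\<And>s t. t \<in> T \<Longrightarrow> (F s has_real_derivative Ft s t) (at t)"
    and Fst: "\<And>s t. t \<in> T \<Longrightarrow> ((\<lambda>s. Ft s t) has_real_derivative Fst s t) (at s)"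
    and contt: "\<And>s. continuous_on T (Ft s)"
    and cont: "continuous_on (UNIV \<times> T) (\<lambda>(s, t). Fst s t)"
  shows "(Fs s has_real_derivative Fst s t0) (at t0)"
proof -
  obtain r where r: "r > 0" "cball t0 r \<subseteq> T"
    using T open_contains_cball by blast
  define a b where "a = t0 - r" and "b = t0 + r"
  have ab: "{a..b} \<subseteq> T" "a < t0" "t0 < b"
    using r by (auto simp: a_def b_def cball_eq_atLeastAtMost)
  have eq: "Fs s t = Fs s a + integral {a..t} (Fst s)" if t: "t \<in> {a..b}" for t
  proof -
    have sub: "{a..t} \<subseteq> T" using t ab by auto
    have "((\<lambda>s. integral (cbox a t) (Ft s)) has_real_derivative integral (cbox a t) (Fst s)) (at s within UNIV)"
    proof (rule leibniz_rule_field_derivative)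
      show "continuous_on (UNIV \<times> cbox a t) (\<lambda>(s, t). Fst s t)"
        by (rule continuous_on_subset [OF cont]) (use sub in auto)
      show "Ft s integrable_on cbox a t" for s
        using sub by (intro integrable_continuous continuous_on_subset [OF contt]) auto
    qed (use Fst sub in \<open>auto simp: subset_iff\<close>)
    moreover have "integral (cbox a t) (Ft s) = F s t - F s a" for s
    proof -
      have "(Ft s has_integral F s t - F s a) {a..t}"
        using t sub by (intro fundamental_theorem_of_calculus)
          (auto intro!: Ft [THEN has_field_derivative_at_within] simp: has_real_derivative_iff_has_vector_derivative [symmetric] subset_iff)
      then show ?thesis by (simp add: integral_unique)
    qed
    ultimately have "((\<lambda>s. F s t - F s a) has_real_derivative integral {a..t} (Fst s)) (at s)"
      by simp
    moreover have "((\<lambda>s. F s t - F s a) has_real_derivative Fs s t - Fs s a) (at s)"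
      using t ab by (intro DERIV_diff Fs) auto
    ultimately have "Fs s t - Fs s a = integral {a..t} (Fst s)"
      by (rule DERIV_unique [rotated])
    then show ?thesis by simp
  qed
  have "continuous_on {a..b} (Fst s)"
    using continuous_on_compose2 [OF cont continuous_on_Pair [OF continuous_on_const continuous_on_id], of s "{a..b}"] ab
    by auto
  then have "((\<lambda>t. integral {a..t} (Fst s)) has_real_derivative Fst s t0) (at t0 within {a..b})"
    using ab by (intro integral_has_real_derivative) auto
  then have "((\<lambda>t. integral {a..t} (Fst s)) has_real_derivative Fst s t0) (at t0)"
    using ab at_within_Icc_at [of a t0 b] by simp
  then have "((\<lambda>t. Fs s a + integral {a..t} (Fst s)) has_real_derivative Fst s t0) (at t0)"
    by (auto intro!: derivative_eq_intros)
  then show ?thesis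
    by (rule has_field_derivative_transform_within_open [of _ _ _ "{a<..<b}"]) (use ab in \<open>auto intro!: eq [symmetric]\<close>)
qed

text \<open>The iterates of d/d(t^2) = (1/2t) d/dt on t \<mapsto> h (x + t w).\<close>

primrec radial_deriv :: "nat \<Rightarrow> (real^'m \<Rightarrow> real) \<Rightarrow> real^'m \<Rightarrow> real \<Rightarrow> real^'m \<Rightarrow> real" where
  "radial_deriv 0 h = (\<lambda>x t w. h (x + t *\<^sub>R w))"
| "radial_deriv (Suc j) h = (\<lambda>x t w. deriv (\<lambda>s. radial_deriv j h x s w) t / (2 * t))"

lemma radial_deriv_radial_funs:
  assumes "smooth_fun h"
  shows "radial_deriv j h \<in> radial_funs"
proof (induction j)
  case 0
  then show ?case using assms by (simp add: radial_funs.smooth)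
next
  case (Suc j)
  obtain F' where F': "F' \<in> radial_funs"
    "\<And>x t w. t \<noteq> 0 \<Longrightarrow> ((\<lambda>t. radial_deriv j h x t w) has_real_derivative F' x t w) (at t)"
    using radial_funs_deriv_t [OF Suc] by blast
  have "(\<lambda>x t w. 1/2 * (F' x t w * (1 / t))) \<in> radial_funs"
    using F'(1) by (intro radial_funs.mult radial_funs.const radial_funs.inverse)
  then show ?case
    by (rule radial_funs.cong) (auto simp: DERIV_imp_deriv [OF F'(2)])
qed

lemma radial_deriv_DERIV_t:
  assumes "smooth_fun h" "t \<noteq> 0"
  shows "((\<lambda>t. radial_deriv j h x t w) has_real_derivative 2 * t * radial_deriv (Suc j) h x t w) (at t)"
proof -
  obtain D where "((\<lambda>t. radial_deriv j h x t w) has_real_derivative D) (at t)"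
    using radial_funs_deriv_t [OF radial_deriv_radial_funs [OF assms(1)]] assms(2) by blast
  then show ?thesis
    using assms(2) by (simp add: DERIV_imp_deriv)
qed

text \<open>At level j + 1 the class of radial functions supplies some derivative G in the centre.
  Exchanging the order of differentiation shows that 2 t G is the t-derivative of level j for
  \<open>partial_deriv i h\<close>, and uniqueness of derivatives identifies G.\<close>

lemma radial_deriv_DERIV_x:
  assumes h: "smooth_fun h" and i: "i \<in> Basis" and t: "t \<noteq> 0"
  shows "((\<lambda>s. radial_deriv j h (x + s *\<^sub>R i) t w) has_real_derivative radial_deriv j (partial_deriv i h) (x + s *\<^sub>R i) t w) (at s)"
  using t
proof (induction j arbitrary: s t)
  case 0
  show ?case
    using smooth_fun_DERIV_line [OF h, of "x + t *\<^sub>R w" i s] i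
    by (simp add: inner_Basis if_distrib [where f = "\<lambda>z. z * _"] sum.delta add_ac cong: if_cong)
next
  case (Suc j)
  obtain G where G: "G \<in> radial_funs"
    "\<And>x t w s. t \<noteq> 0 \<Longrightarrow>
      ((\<lambda>s. radial_deriv (Suc j) h (x + s *\<^sub>R i) t w) has_real_derivative G (x + s *\<^sub>R i) t w) (at s)"
    using radial_funs_deriv_x [OF radial_deriv_radial_funs [OF h] i] by blast
  have "((\<lambda>t. radial_deriv j (partial_deriv i h) (x + s *\<^sub>R i) t w) has_real_derivative 2 * t * G (x + s *\<^sub>R i) t w) (at t)"
  proof (rule mixed_partials_commute [where T = "- {0}" and F = "\<lambda>s t. radial_deriv j h (x + s *\<^sub>R i) t w"
        and Fs = "\<lambda>s t. radial_deriv j (partial_deriv i h) (x + s *\<^sub>R i) t w" and Fst = "\<lambda>s t. 2 * t * G (x + s *\<^sub>R i) t w"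
        and Ft = "\<lambda>s t. 2 * t * radial_deriv (Suc j) h (x + s *\<^sub>R i) t w"])
    show "((\<lambda>s. radial_deriv j h (x + s *\<^sub>R i) t w) has_real_derivative radial_deriv j (partial_deriv i h) (x + s *\<^sub>R i) t w) (at s)"
      if "t \<in> - {0}" for s t
      using Suc.IH that by simp
    show "((\<lambda>t. radial_deriv j h (x + s *\<^sub>R i) t w) has_real_derivative 2 * t * radial_deriv (Suc j) h (x + s *\<^sub>R i) t w) (at t)"
      if "t \<in> - {0}" for s t
      using radial_deriv_DERIV_t [OF h] that by simp
    show "((\<lambda>s. 2 * t * radial_deriv (Suc j) h (x + s *\<^sub>R i) t w) has_real_derivative 2 * t * G (x + s *\<^sub>R i) t w) (at s)"
      if "t \<in> - {0}" for s t
      using that by (intro DERIV_cmult G(2)) auto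
    show "continuous_on (- {0}) (\<lambda>t. 2 * t * radial_deriv (Suc j) h (x + s *\<^sub>R i) t w)" for s
      by (intro continuous_intros radial_funs_continuous_on_compose [OF radial_deriv_radial_funs [OF h]]) auto
    show "continuous_on (UNIV \<times> - {0}) (\<lambda>(s, t). 2 * t * G (x + s *\<^sub>R i) t w)"
      unfolding case_prod_unfold
      by (intro continuous_intros radial_funs_continuous_on_compose [OF G(1)]) auto
  qed (use Suc.prems in auto)
  then have "2 * t * G (x + s *\<^sub>R i) t w = 2 * t * radial_deriv (Suc j) (partial_deriv i h) (x + s *\<^sub>R i) t w"
    using radial_deriv_DERIV_t [OF smooth_fun_partial [OF h i] Suc.prems] by (rule DERIV_unique)
  then have "G (x + s *\<^sub>R i) t w = radial_deriv (Suc j) (partial_deriv i h) (x + s *\<^sub>R i) t w"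
    using Suc.prems by (simp del: radial_deriv.simps)
  then show ?case
    using G(2) [OF Suc.prems, of x w s] by (simp del: radial_deriv.simps)
qed

lemma radial_deriv_continuous_on_sphere:
  assumes "smooth_fun h" "t \<noteq> 0"
  shows "continuous_on S (radial_deriv j h x t)"
  using assms by (intro radial_funs_continuous_on_compose [OF radial_deriv_radial_funs [OF assms(1)]] continuous_intros) auto

section \<open>The classical Darboux equation\<close>

text \<open>For t > 0 and s = t^2 this is the j-th s-derivative of the sphere integral of h (x +
  sqrt s w). The derivatives are put under the integral from the start;
  \<open>radial_mean_DERIV_t\<close> shows that this is legitimate.\<close>

definition radial_mean :: "nat \<Rightarrow> (real^'m \<Rightarrow> real) \<Rightarrow> real^'m \<Rightarrow> real \<Rightarrow> real" where
  "radial_mean j h x t = surface_int (radial_deriv j h x t)"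

lemma radial_mean_DERIV_t:
  assumes h: "smooth_fun h" and t: "t \<noteq> 0"
  shows "(radial_mean j h x has_real_derivative 2 * t * radial_mean (Suc j) h x t) (at t)"
proof -
  have "((\<lambda>t. surface_int (radial_deriv j h x t)) has_real_derivative surface_int (\<lambda>w. 2 * t * radial_deriv (Suc j) h x t w)) (at t)"
  proof (rule surface_int_has_real_derivative [where S = "- {0}" and F' = "\<lambda>t w. 2 * t * radial_deriv (Suc j) h x t w"])
    show "continuous_on ((- {0}) \<times> sphere 0 1) (\<lambda>(t, w). 2 * t * radial_deriv (Suc j) h x t w)"
      unfolding case_prod_unfold
      by (intro continuous_intros radial_funs_continuous_on_compose [OF radial_deriv_radial_funs [OF h]]) auto
  qed (use t h in \<open>auto intro!: radial_deriv_DERIV_t radial_deriv_continuous_on_sphere simp del: radial_deriv.simps\<close>)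
  then show ?thesis
    unfolding surface_int_cmult radial_mean_def .
qed

lemma radial_mean_DERIV_x:
  assumes h: "smooth_fun h" and i: "i \<in> Basis" and t: "t \<noteq> 0"
  shows "((\<lambda>s. radial_mean j h (x + s *\<^sub>R i) t) has_real_derivative radial_mean j (partial_deriv i h) (x + s *\<^sub>R i) t) (at s)"
  unfolding radial_mean_def
proof (rule surface_int_has_real_derivative [where S = UNIV])
  show "continuous_on (UNIV \<times> sphere 0 1) (\<lambda>(s, w). radial_deriv j (partial_deriv i h) (x + s *\<^sub>R i) t w)"
    unfolding case_prod_unfold using t
    by (intro continuous_intros radial_funs_continuous_on_compose [OF radial_deriv_radial_funs [OF smooth_fun_partial [OF h i]]]) auto
qed (use assms in \<open>auto intro!: radial_deriv_DERIV_x radial_deriv_continuous_on_sphere\<close>)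

section \<open>Rotation invariance and its infinitesimal form\<close>

lemma orthogonal_transformation_plane_rotation:
  fixes e f :: "'a::euclidean_space"
  assumes "e \<in> Basis" "f \<in> Basis" "e \<noteq> f"
  shows "orthogonal_transformation (\<lambda>y. y + ((cos \<theta> - 1) * (y \<bullet> e) - sin \<theta> * (y \<bullet> f)) *\<^sub>R e
    + (sin \<theta> * (y \<bullet> e) + (cos \<theta> - 1) * (y \<bullet> f)) *\<^sub>R f)"
proof -
  have [simp]: "e \<bullet> f = 0" "f \<bullet> e = 0" "e \<bullet> e = 1" "f \<bullet> f = 1"
    using assms by (auto simp: inner_Basis)
  define c s where "c = cos \<theta>" and "s = sin \<theta>"
  have cs: "c * c + s * s = 1"
    by (simp add: c_def s_def flip: power2_eq_square)
  show ?thesis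
    unfolding orthogonal_transformation_def c_def [symmetric] s_def [symmetric]
  proof (intro conjI allI)
    show "linear (\<lambda>y. y + ((c - 1) * (y \<bullet> e) - s * (y \<bullet> f)) *\<^sub>R e + (s * (y \<bullet> e) + (c - 1) * (y \<bullet> f)) *\<^sub>R f)"
      by (rule linearI) (simp_all add: inner_add_left algebra_simps)
    fix v w :: 'a
    \<comment> \<open>Writing the rotation as the identity plus a correction in the plane of e and f
      collects everything beyond the inner product of v and w under the factor c^2 + s^2 -
      1.\<close>
    have "(v + ((c - 1) * (v \<bullet> e) - s * (v \<bullet> f)) *\<^sub>R e + (s * (v \<bullet> e) + (c - 1) * (v \<bullet> f)) *\<^sub>R f) \<bullet>
       (w + ((c - 1) * (w \<bullet> e) - s * (w \<bullet> f)) *\<^sub>R e + (s * (w \<bullet> e) + (c - 1) * (w \<bullet> f)) *\<^sub>R f)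
       = v \<bullet> w + (c * c + s * s - 1) * ((v \<bullet> e) * (w \<bullet> e) + (v \<bullet> f) * (w \<bullet> f))"
      by (simp add: inner_add_left inner_add_right inner_commute [of e w] inner_commute [of f w] algebra_simps)
    then show "(v + ((c - 1) * (v \<bullet> e) - s * (v \<bullet> f)) *\<^sub>R e + (s * (v \<bullet> e) + (c - 1) * (v \<bullet> f)) *\<^sub>R f) \<bullet>
       (w + ((c - 1) * (w \<bullet> e) - s * (w \<bullet> f)) *\<^sub>R e + (s * (w \<bullet> e) + (c - 1) * (w \<bullet> f)) *\<^sub>R f) = v \<bullet> w"
      by (simp add: cs)
  qed
qed

text \<open>The integral of u composed with a rotation in the plane of e and f does not depend on
  the angle. Its derivative at angle 0 is the integral of the rotation's generator applied to
  u.\<close>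

lemma surface_int_rotation_generator:
  fixes u :: "real^'m \<Rightarrow> real"
  assumes ef: "e \<in> Basis" "f \<in> Basis"
    and u: "\<And>y. (u has_derivative (\<lambda>v. \<Sum>i\<in>Basis. (v \<bullet> i) * u' i y)) (at y)"
    and u': "\<And>i. i \<in> Basis \<Longrightarrow> continuous_on UNIV (u' i)"
  shows "surface_int (\<lambda>w. (w \<bullet> e) * u' f w - (w \<bullet> f) * u' e w) = 0"
proof (cases "e = f")
  case True
  then show ?thesis by (simp add: surface_int_def)
next
  case False
  define R where "R = (\<lambda>\<theta> y. y + ((cos \<theta> - 1) * (y \<bullet> e) - sin \<theta> * (y \<bullet> f)) *\<^sub>R e
    + (sin \<theta> * (y \<bullet> e) + (cos \<theta> - 1) * (y \<bullet> f)) *\<^sub>R f)"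
  define R' where "R' = (\<lambda>\<theta> y. (- sin \<theta> * (y \<bullet> e) - cos \<theta> * (y \<bullet> f)) *\<^sub>R e
    + (cos \<theta> * (y \<bullet> e) - sin \<theta> * (y \<bullet> f)) *\<^sub>R f)"
  have contu: "continuous_on S u" for S
    by (intro continuous_at_imp_continuous_on ballI has_derivative_continuous [OF u])
  have contR: "continuous_on S (\<lambda>p. R (fst p) (snd p))" for S
    unfolding R_def by (intro continuous_intros)
  have "((\<lambda>\<theta>. surface_int (\<lambda>w. u (R \<theta> w))) has_real_derivative
      surface_int (\<lambda>w. \<Sum>i\<in>Basis. (R' 0 w \<bullet> i) * u' i (R 0 w))) (at 0)"
  proof (rule surface_int_has_real_derivative [where S = UNIV
        and F' = "\<lambda>\<theta> w. \<Sum>i\<in>Basis. (R' \<theta> w \<bullet> i) * u' i (R \<theta> w)"])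
    fix \<theta> :: real and w :: "real^'m"
    have "((\<lambda>\<theta>. R \<theta> w) has_derivative (\<lambda>s. s *\<^sub>R R' \<theta> w)) (at \<theta>)"
      unfolding R_def R'_def by (auto intro!: derivative_eq_intros simp: fun_eq_iff algebra_simps)
    from has_derivative_compose [OF this u]
    show "((\<lambda>\<theta>. u (R \<theta> w)) has_real_derivative (\<Sum>i\<in>Basis. (R' \<theta> w \<bullet> i) * u' i (R \<theta> w))) (at \<theta>)"
      unfolding has_field_derivative_def
      by (rule has_derivative_eq_rhs) (simp add: fun_eq_iff sum_distrib_left mult_ac)
    show "continuous_on (sphere 0 1) (\<lambda>w. u (R \<theta> w))"
      by (rule continuous_on_compose2 [OF contu [of UNIV]]) (auto simp: R_def intro!: continuous_intros)
  next
    show "continuous_on (UNIV \<times> sphere 0 1) (\<lambda>(\<theta>, w). \<Sum>i\<in>Basis. (R' \<theta> w \<bullet> i) * u' i (R \<theta> w))"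
      unfolding case_prod_unfold R'_def
      by (intro continuous_on_sum continuous_on_mult continuous_on_compose2 [OF u' contR])
        (auto intro!: continuous_intros)
  qed auto
  moreover have "surface_int (\<lambda>w. u (R \<theta> w)) = surface_int u" for \<theta>
    unfolding R_def by (rule surface_int_orthogonal [OF orthogonal_transformation_plane_rotation [OF ef False] contu])
  ultimately have "((\<lambda>\<theta>::real. surface_int u) has_real_derivative
      surface_int (\<lambda>w. \<Sum>i\<in>Basis. (R' 0 w \<bullet> i) * u' i (R 0 w))) (at 0)"
    by simp
  then have "surface_int (\<lambda>w. \<Sum>i\<in>Basis. (R' 0 w \<bullet> i) * u' i (R 0 w)) = 0"
    by (rule DERIV_unique) auto
  moreover have "(\<Sum>i\<in>Basis. (R' 0 w \<bullet> i) * u' i (R 0 w)) = (w \<bullet> e) * u' f w - (w \<bullet> f) * u' e w" for w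
  proof -
    have "(\<Sum>i\<in>Basis. (R' 0 w \<bullet> i) * u' i (R 0 w)) =
      (\<Sum>i\<in>Basis. (if i = f then (w \<bullet> e) * u' f w else 0) - (if i = e then (w \<bullet> f) * u' e w else 0))"
      using ef by (intro sum.cong) (auto simp: R_def R'_def inner_diff_left inner_Basis)
    then show ?thesis
      using ef by (simp add: sum_subtractf)
  qed
  ultimately show ?thesis by simp
qed


lemma radial_deriv_1:
  assumes "smooth_fun h"
  shows "radial_deriv 1 h x t w = (\<Sum>f\<in>Basis. (w \<bullet> f) * partial_deriv f h (x + t *\<^sub>R w)) / (2 * t)"
  by (simp add: DERIV_imp_deriv [OF smooth_fun_DERIV_line [OF assms]])

text \<open>For D = (1/(2t)) d/dt one has 4 t^2 D^2 = d^2/dt^2 - (1/t) d/dt, here along the line x +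
  t w.\<close>

lemma radial_deriv_2:
  assumes h: "smooth_fun h" and t: "t \<noteq> 0"
  shows "4 * t\<^sup>2 * radial_deriv 2 h x t w = (\<Sum>e\<in>Basis. \<Sum>f\<in>Basis. (w \<bullet> e) * (w \<bullet> f) * partial_deriv e (partial_deriv f h) (x + t *\<^sub>R w))
    - (\<Sum>f\<in>Basis. (w \<bullet> f) * partial_deriv f h (x + t *\<^sub>R w)) / t"
proof -
  let ?q = "\<lambda>t. \<Sum>f\<in>Basis. (w \<bullet> f) * partial_deriv f h (x + t *\<^sub>R w)"
  let ?r = "\<Sum>f\<in>Basis. (w \<bullet> f) * (\<Sum>e\<in>Basis. (w \<bullet> e) * partial_deriv e (partial_deriv f h) (x + t *\<^sub>R w))"
  have "(?q has_real_derivative ?r) (at t)"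
    by (intro DERIV_sum DERIV_cmult smooth_fun_DERIV_line smooth_fun_partial h)
  then have *: "((\<lambda>t. ?q t / (2 * t)) has_real_derivative (?r * (2 * t) - ?q t * 2) / (2 * t * (2 * t))) (at t)"
    using t by (intro DERIV_divide) (auto intro!: derivative_eq_intros)
  have "radial_deriv 2 h x t w = (?r * (2 * t) - ?q t * 2) / (2 * t * (2 * t)) / (2 * t)"
  proof -
    have "radial_deriv 2 h x t w = deriv (\<lambda>s. radial_deriv 1 h x s w) t / (2 * t)"
      unfolding numeral_2_eq_2 One_nat_def radial_deriv.simps(2) [of "Suc 0"] ..
    then show ?thesis
      unfolding radial_deriv_1 [OF h] using * by (simp only: DERIV_imp_deriv)
  qed
  moreover have "?r = (\<Sum>e\<in>Basis. \<Sum>f\<in>Basis. (w \<bullet> e) * (w \<bullet> f) * partial_deriv e (partial_deriv f h) (x + t *\<^sub>R w))"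
    by (subst sum.swap) (simp add: sum_distrib_left mult_ac)
  ultimately show ?thesis
    using t by (simp add: field_simps power2_eq_square)
qed

text \<open>With u_ef(y) = y_e (\<partial>_f h)(x + t y), the sum over e, f of (y_e \<partial>_f - y_f \<partial>_e) u_ef equals
  t \<Delta>h minus its radial part on the unit sphere, and each summand has integral 0 by rotation invariance.\<close>

lemma radial_mean_darboux:
  fixes h :: "real^'m \<Rightarrow> real"
  assumes h: "smooth_fun h" and t: "t \<noteq> 0"
  shows "(\<Sum>i\<in>Basis. radial_mean 0 (partial_deriv i (partial_deriv i h)) x t)
    = 4 * t\<^sup>2 * radial_mean 2 h x t + 2 * real CARD('m) * radial_mean 1 h x t"
proof -
  define p where "p = (\<lambda>f w. partial_deriv f h (x + t *\<^sub>R w))"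
  define pp where "pp = (\<lambda>e f w. partial_deriv e (partial_deriv f h) (x + t *\<^sub>R w))"
  have contp: "continuous_on S (p f)" if "f \<in> Basis" for f S
    unfolding p_def
    by (rule continuous_on_compose2 [OF smooth_fun_continuous_on [OF smooth_fun_partial [OF h that], of UNIV]])
      (auto intro!: continuous_intros)
  have contpp: "continuous_on S (pp e f)" if "e \<in> Basis" "f \<in> Basis" for e f S
    unfolding pp_def
    by (rule continuous_on_compose2 [OF smooth_fun_continuous_on [OF smooth_fun_partial [OF smooth_fun_partial [OF h that(2)] that(1)], of UNIV]])
      (auto intro!: continuous_intros)
  let ?Z = "\<lambda>e f w. (w \<bullet> e) * ((f \<bullet> e) * p f w + (w \<bullet> e) * (t * pp f f w))
      - (w \<bullet> f) * ((e \<bullet> e) * p f w + (w \<bullet> e) * (t * pp e f w))"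
  have Z: "surface_int (?Z e f) = 0" if ef: "e \<in> Basis" "f \<in> Basis" for e f :: "real^'m"
  \<comment> \<open>The supplied \<open>u'\<close> is the gradient of
    \<open>(y \<bullet> e) * p f y\<close> by the product rule; differentiating \<open>p f\<close>
    brings out the factor t.\<close>
  proof (rule surface_int_rotation_generator [OF ef, where u' = "\<lambda>i w. (i \<bullet> e) * p f w + (w \<bullet> e) * (t * pp i f w)"])
    show "continuous_on UNIV (\<lambda>w. (i \<bullet> e) * p f w + (w \<bullet> e) * (t * pp i f w))" if "i \<in> Basis" for i
      using ef that by (intro continuous_intros contp contpp)
    fix y
    have "((\<lambda>y. x + t *\<^sub>R y) has_derivative (\<lambda>v. t *\<^sub>R v)) (at y)"
      by (auto intro!: derivative_eq_intros)
    from has_derivative_compose [OF this smooth_fun_has_derivative [OF smooth_fun_partial [OF h ef(2)]]]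
    have "(p f has_derivative (\<lambda>v. \<Sum>i\<in>Basis. (t *\<^sub>R v \<bullet> i) * pp i f y)) (at y)"
      by (simp add: p_def pp_def)
    then have "((\<lambda>y. (y \<bullet> e) * p f y) has_derivative
        (\<lambda>v. (y \<bullet> e) * (\<Sum>i\<in>Basis. (t *\<^sub>R v \<bullet> i) * pp i f y) + (v \<bullet> e) * p f y)) (at y)"
      by (intro has_derivative_mult) (auto intro!: derivative_eq_intros)
    then show "((\<lambda>y. (y \<bullet> e) * p f y) has_derivative
        (\<lambda>v. \<Sum>i\<in>Basis. (v \<bullet> i) * ((i \<bullet> e) * p f y + (y \<bullet> e) * (t * pp i f y)))) (at y)"
    proof (rule has_derivative_eq_rhs, intro ext)
      fix v
      have "v \<bullet> e = (\<Sum>i\<in>Basis. (v \<bullet> i) * (i \<bullet> e))"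
        by (subst euclidean_inner) (simp add: inner_commute)
      then show "(y \<bullet> e) * (\<Sum>i\<in>Basis. (t *\<^sub>R v \<bullet> i) * pp i f y) + (v \<bullet> e) * p f y =
        (\<Sum>i\<in>Basis. (v \<bullet> i) * ((i \<bullet> e) * p f y + (y \<bullet> e) * (t * pp i f y)))"
        by (simp add: sum_distrib_left sum_distrib_right ring_distribs sum.distrib mult_ac)
    qed
  qed
  let ?L = "\<lambda>w. \<Sum>f\<in>Basis. pp f f w"
  have "0 = (\<Sum>e\<in>Basis. \<Sum>f\<in>Basis. surface_int (?Z e f))"
    by (rule sym, intro sum.neutral ballI Z)
  also have "\<dots> = surface_int (\<lambda>w. \<Sum>e\<in>Basis. \<Sum>f\<in>Basis. ?Z e f w)"
  proof -
    have cont: "continuous_on (sphere 0 1) (?Z e f)" if "e \<in> Basis" "f \<in> Basis" for e f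
      using that by (intro continuous_intros contp contpp)
    have "(\<Sum>e\<in>Basis. \<Sum>f\<in>Basis. surface_int (?Z e f)) = (\<Sum>e\<in>Basis. surface_int (\<lambda>w. \<Sum>f\<in>Basis. ?Z e f w))"
      by (intro sum.cong refl surface_int_sum [symmetric] cont) auto
    also have "\<dots> = surface_int (\<lambda>w. \<Sum>e\<in>Basis. \<Sum>f\<in>Basis. ?Z e f w)"
      by (intro surface_int_sum [symmetric] continuous_on_sum cont) auto
    finally show ?thesis .
  qed
  also have "\<dots> = surface_int (\<lambda>w. t * (?L w - (4 * t\<^sup>2 * radial_deriv 2 h x t w + 2 * real CARD('m) * radial_deriv 1 h x t w)))"
  proof (rule surface_int_cong)
    fix w :: "real^'m"
    assume w: "norm w = 1"
    define q where "q = (\<Sum>f\<in>Basis. (w \<bullet> f) * p f w)"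
    define r where "r = (\<Sum>e\<in>Basis. \<Sum>f\<in>Basis. (w \<bullet> e) * (w \<bullet> f) * pp e f w)"
    \<comment> \<open>Here the restriction to the sphere enters: the squares of the coordinates sum
      to 1, which isolates the Laplacian. The dimension enters below as the number of summands
      \<open>e \<bullet> e\<close>.\<close>
    have "(\<Sum>e\<in>Basis. (w \<bullet> e) * (w \<bullet> e)) = 1"
      using w by (simp add: euclidean_inner [symmetric] dot_square_norm)
    then have "(\<Sum>e\<in>Basis. \<Sum>f\<in>Basis. (w \<bullet> e) * ((w \<bullet> e) * (t * pp f f w))) = t * ?L w"
      by (simp add: sum_distrib_left [symmetric] sum_distrib_right [symmetric] mult.assoc [symmetric])
    moreover have "(\<Sum>e\<in>Basis. \<Sum>f\<in>Basis. (w \<bullet> e) * ((f \<bullet> e) * p f w)) = q"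
      by (simp add: q_def inner_Basis if_distrib [where f = "\<lambda>z. z * _"] if_distrib [where f = "\<lambda>z. _ * z"] cong: if_cong)
    moreover have "(\<Sum>e::real^'m\<in>Basis. \<Sum>f\<in>Basis. (w \<bullet> f) * ((e \<bullet> e) * p f w)) = real CARD('m) * q"
      by (simp add: q_def)
    moreover have "(\<Sum>e\<in>Basis. \<Sum>f\<in>Basis. (w \<bullet> f) * ((w \<bullet> e) * (t * pp e f w))) = t * r"
      by (simp add: r_def sum_distrib_left mult_ac)
    ultimately have E: "(\<Sum>e\<in>Basis. \<Sum>f\<in>Basis. ?Z e f w) = q + t * ?L w - (real CARD('m) * q + t * r)"
      by (simp add: ring_distribs sum.distrib sum_subtractf)
    have R: "4 * t\<^sup>2 * radial_deriv 2 h x t w = r - q / t" "radial_deriv 1 h x t w = q / (2 * t)"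
      using radial_deriv_2 [OF h t] radial_deriv_1 [OF h] by (simp_all add: q_def r_def p_def pp_def)
    show "(\<Sum>e\<in>Basis. \<Sum>f\<in>Basis. ?Z e f w) =
        t * (?L w - (4 * t\<^sup>2 * radial_deriv 2 h x t w + 2 * real CARD('m) * radial_deriv 1 h x t w))"
      unfolding E R using t by (simp add: field_simps)
  qed
  also have "\<dots> = t * ((\<Sum>f\<in>Basis. surface_int (pp f f)) - (4 * t\<^sup>2 * radial_mean 2 h x t + 2 * real CARD('m) * radial_mean 1 h x t))"
  proof -
    have R: "continuous_on (sphere 0 1) (\<lambda>w. c * radial_deriv j h x t w)" for c j
      using h t by (intro continuous_intros radial_deriv_continuous_on_sphere)
    have L: "continuous_on (sphere 0 1) ?L"
      by (intro continuous_on_sum contpp)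
    show ?thesis
      unfolding radial_mean_def surface_int_cmult surface_int_diff [OF L continuous_on_add [OF R R]] surface_int_add [OF R R]
      by (subst surface_int_sum) (auto simp: contpp)
  qed
  finally have "(\<Sum>f\<in>Basis. surface_int (pp f f)) = 4 * t\<^sup>2 * radial_mean 2 h x t + 2 * real CARD('m) * radial_mean 1 h x t"
    using t by simp
  then show ?thesis
    by (simp add: radial_mean_def pp_def)
qed

text \<open>If u j is the j-th derivative of H at s = 1/z, the sum on the left is s^(-a) times the Taylor coefficient
  of order N + 1 of s^a H(s); the identity results from differentiating the coefficient of order N.\<close>

lemma binomial_taylor_step:
  fixes a z :: real and u :: "nat \<Rightarrow> real"
  shows "real (Suc N) * (\<Sum>k\<le>Suc N. (a gchoose k) * z ^ k * u (Suc N - k) / fact (Suc N - k)) =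
    (\<Sum>k\<le>N. (a gchoose k) * z ^ k * u (Suc N - k) / fact (N - k)) +
    (\<Sum>k\<le>N. (a - real k) * (a gchoose k) * z ^ Suc k * u (N - k) / fact (N - k))"
proof -
  let ?T = "\<lambda>k. (a gchoose k) * z ^ k * u (Suc N - k) / fact (Suc N - k)"
  \<comment> \<open>N + 1 is split as (N + 1 - k) + k. The first part lowers the factorial; the
    second turns the binomial coefficient at k into (a - k + 1) times the one at k - 1.\<close>
  have "real (Suc N) * (\<Sum>k\<le>Suc N. ?T k) = (\<Sum>k\<le>Suc N. real (Suc N - k) * ?T k) + (\<Sum>k\<le>Suc N. real k * ?T k)"
    unfolding sum_distrib_left sum.distrib [symmetric]
  proof (intro sum.cong refl)
    fix k
    assume "k \<in> {..Suc N}"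
    then have "real (Suc N) = real (Suc N - k) + real k"
      by simp
    then show "real (Suc N) * ?T k = real (Suc N - k) * ?T k + real k * ?T k"
      by (simp only: distrib_right)
  qed
  also have "(\<Sum>k\<le>Suc N. real (Suc N - k) * ?T k) = (\<Sum>k\<le>N. real (Suc N - k) * ?T k)"
    by simp
  also have "\<dots> = (\<Sum>k\<le>N. (a gchoose k) * z ^ k * u (Suc N - k) / fact (N - k))"
  proof (intro sum.cong refl)
    fix k
    assume k: "k \<in> {..N}"
    define c where "c = real (Suc N - k)"
    have "c \<noteq> 0" "fact (Suc N - k) = c * fact (N - k)"
      using k by (simp_all add: c_def Suc_diff_le)
    then show "real (Suc N - k) * ?T k = (a gchoose k) * z ^ k * u (Suc N - k) / fact (N - k)"
      unfolding c_def [symmetric] by simp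
  qed
  also have "(\<Sum>k\<le>Suc N. real k * ?T k) = (\<Sum>k\<le>N. real (Suc k) * ?T (Suc k))"
    by (subst sum.atMost_Suc_shift) simp
  also have "\<dots> = (\<Sum>k\<le>N. (a - real k) * (a gchoose k) * z ^ Suc k * u (N - k) / fact (N - k))"
  proof (intro sum.cong refl)
    fix k
    have "real (Suc k) * (a gchoose Suc k) = (a - real k) * (a gchoose k)"
      using gbinomial_absorb_comp [of a k] gbinomial_absorption [of k "a"] by (simp add: mult.commute)
    then show "real (Suc k) * ?T (Suc k) = (a - real k) * (a gchoose k) * z ^ Suc k * u (N - k) / fact (N - k)"
      by (simp only: diff_Suc_Suc times_divide_eq_right mult.assoc [symmetric])
  qed
  finally show ?thesis .
qed

text \<open>With s = t^2 and H(s) the sphere integral of h (x + sqrt s w), this is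
  s^(n - a) (d/ds)^N (s^a H(s)).\<close>

definition weighted_mean :: "real \<Rightarrow> nat \<Rightarrow> nat \<Rightarrow> (real^'m \<Rightarrow> real) \<Rightarrow> real^'m \<Rightarrow> real \<Rightarrow> real" where
  "weighted_mean a n N h x t = fact N * t ^ (2 * n) *
    (\<Sum>k\<le>N. (a gchoose k) * (1 / t\<^sup>2) ^ k * radial_mean (N - k) h x t / fact (N - k))"

section \<open>Derivatives and even Laplacian of the weighted means\<close>

lemma weighted_mean_DERIV_x:
  assumes "smooth_fun h" "i \<in> Basis" "t \<noteq> 0"
  shows "((\<lambda>s. weighted_mean a n N h (x + s *\<^sub>R i) t) has_real_derivative weighted_mean a n N (partial_deriv i h) (x + s *\<^sub>R i) t) (at s)"
  unfolding weighted_mean_def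
  by (intro DERIV_cmult DERIV_sum DERIV_cdivide radial_mean_DERIV_x assms)

text \<open>The product rule for s^(n - a) times the N-th s-derivative of s^a H(s), with d/dt = 2 t
  d/ds. The computation stays with the explicit Leibniz sum, whose powers are all integral, so that
  no real powers of t occur.\<close>

lemma weighted_mean_DERIV_t:
  assumes h: "smooth_fun h" and t: "t \<noteq> 0"
  shows "(weighted_mean a n N h x has_real_derivative
    2 * t * ((real n - a) / t\<^sup>2 * weighted_mean a n N h x t + weighted_mean a n (Suc N) h x t)) (at t)"
proof -
  define H where "H = (\<lambda>j. radial_mean j h x t)"
  define z where "z = 1 / t\<^sup>2"
  have pow: "((\<lambda>t. (1 / t\<^sup>2) ^ k) has_real_derivative - 2 * t * (real k * z ^ Suc k)) (at t)" for k
  proof -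
    have "((\<lambda>t. 1 / t\<^sup>2) has_real_derivative - 2 * t * z\<^sup>2) (at t)"
      using t by (auto intro!: derivative_eq_intros simp: z_def field_simps power2_eq_square)
    from DERIV_power [OF this, of k] show ?thesis
      by (rule DERIV_cong) (cases k; simp add: power2_eq_square [of z] flip: z_def)
  qed
  have tm: "((\<lambda>t. (a gchoose k) * (1 / t\<^sup>2) ^ k * radial_mean (N - k) h x t / fact (N - k)) has_real_derivative
     (2 * t) * ((a gchoose k) * z ^ k * H (Suc N - k) / fact (N - k)
       - real k * (a gchoose k) * z ^ Suc k * H (N - k) / fact (N - k))) (at t)" if "k \<le> N" for k
  proof -
    have eq: "Suc N - k = Suc (N - k)" using that by simp
    show ?thesis
      by (rule DERIV_cong [OF DERIV_cdivide [OF DERIV_mult [OF DERIV_cmult [OF pow] radial_mean_DERIV_t [OF h t]],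
          of "a gchoose k" k "N - k" x "fact (N - k)"]])
        (simp add: eq H_def z_def [symmetric] diff_divide_distrib [symmetric] right_diff_distrib mult_ac)
  qed
  let ?S = "\<Sum>k\<le>N. (a gchoose k) * z ^ k * H (N - k) / fact (N - k)"
  let ?S' = "\<Sum>k\<le>Suc N. (a gchoose k) * z ^ k * H (Suc N - k) / fact (Suc N - k)"
  have "((\<lambda>t. \<Sum>k\<le>N. (a gchoose k) * (1 / t\<^sup>2) ^ k * radial_mean (N - k) h x t / fact (N - k)) has_real_derivative
     (\<Sum>k\<le>N. (2 * t) * ((a gchoose k) * z ^ k * H (Suc N - k) / fact (N - k)
       - real k * (a gchoose k) * z ^ Suc k * H (N - k) / fact (N - k)))) (at t)"
    by (intro DERIV_sum tm) auto
  also have "(\<Sum>k\<le>N. (2 * t) * ((a gchoose k) * z ^ k * H (Suc N - k) / fact (N - k)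
       - real k * (a gchoose k) * z ^ Suc k * H (N - k) / fact (N - k)))
     = 2 * t * (real (Suc N) * ?S' - a * z * ?S)"
    unfolding binomial_taylor_step
    by (simp add: sum_distrib_left sum_subtractf [symmetric] sum.distrib [symmetric] algebra_simps
         diff_divide_distrib add_divide_distrib)
  finally have S: "((\<lambda>t. \<Sum>k\<le>N. (a gchoose k) * (1 / t\<^sup>2) ^ k * radial_mean (N - k) h x t / fact (N - k)) has_real_derivative
     2 * t * (real (Suc N) * ?S' - a * z * ?S)) (at t)" .
  have "((\<lambda>t. t\<^sup>2) has_real_derivative 2 * t) (at t)"
    by (auto intro!: derivative_eq_intros)
  from DERIV_power [OF this, of n]
  have "((\<lambda>t. t ^ (2 * n)) has_real_derivative 2 * t * (real n * z * t ^ (2 * n))) (at t)"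
    unfolding power_mult by (rule DERIV_cong) (use t in \<open>cases n; simp add: z_def\<close>)
  then have P: "((\<lambda>t. fact N * t ^ (2 * n)) has_real_derivative fact N * (2 * t * (real n * z * t ^ (2 * n)))) (at t)"
    by (rule DERIV_cmult)
  have "(weighted_mean a n N h x has_real_derivative
     fact N * (2 * t * (real n * z * t ^ (2 * n))) * ?S + 2 * t * (real (Suc N) * ?S' - a * z * ?S) * (fact N * t ^ (2 * n))) (at t)"
    using DERIV_mult [OF P S] unfolding weighted_mean_def [abs_def] H_def z_def .
  moreover have "weighted_mean a n N h x t = fact N * t ^ (2 * n) * ?S" "weighted_mean a n (Suc N) h x t = fact (Suc N) * t ^ (2 * n) * ?S'"
    unfolding weighted_mean_def H_def z_def by (rule refl)+
  ultimately show ?thesis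
    by (simp add: z_def algebra_simps diff_divide_distrib del: sum.atMost_Suc)
qed

text \<open>For N = 0 this is the classical Darboux equation conjugated by s^a, with m/2 = a + 1.
  The step differentiates the identity in t: the terms with (n - a)/t^2 cancel by the induction
  hypothesis, and the derivative of the coefficient t^2 raises N + 1 - a by one.\<close>

lemma weighted_mean_laplace:
  fixes h :: "real^'m \<Rightarrow> real"
  defines "a \<equiv> real CARD('m) / 2 - 1"
  assumes h: "smooth_fun h" and t: "t \<noteq> 0"
  shows "(\<Sum>i\<in>Basis. weighted_mean a n N (partial_deriv i (partial_deriv i h)) x t) =
    4 * (t\<^sup>2 * weighted_mean a n (N + 2) h x t + (real N + 1 - a) * weighted_mean a n (N + 1) h x t)"
  using t
proof (induction N arbitrary: t)
  case 0
  let ?z = "1 / t\<^sup>2"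
  have [simp]: "t\<^sup>2 * ?z = 1" using 0 by simp
  have W0: "(\<Sum>i\<in>Basis. weighted_mean a n 0 (partial_deriv i (partial_deriv i h)) x t) = t ^ (2 * n) * (\<Sum>i\<in>Basis. radial_mean 0 (partial_deriv i (partial_deriv i h)) x t)"
    by (simp add: weighted_mean_def sum_distrib_left)
  have W1: "weighted_mean a n 1 h x t = t ^ (2 * n) * (radial_mean 1 h x t + a * ?z * radial_mean 0 h x t)"
    by (simp add: weighted_mean_def)
  have gb: "(a gchoose 2) = a * (a - 1) / 2" and two: "{..2::nat} = {0, 1, 2}"
    by (auto simp: numeral_2_eq_2 gbinomial_Suc_rec field_simps gbinomial_prod_rev)
  have W2: "weighted_mean a n 2 h x t = t ^ (2 * n) * (radial_mean 2 h x t + 2 * a * ?z * radial_mean 1 h x t + a * (a - 1) * ?z * ?z * radial_mean 0 h x t)"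
    unfolding weighted_mean_def two using 0 by (simp add: gb field_simps power2_eq_square)
  have "4 * (t\<^sup>2 * weighted_mean a n 2 h x t + (1 - a) * weighted_mean a n 1 h x t)
    = t ^ (2 * n) * (4 * t\<^sup>2 * radial_mean 2 h x t + 4 * (a + 1) * radial_mean 1 h x t)"
    unfolding W1 W2 using 0 by (simp add: field_simps power2_eq_square)
  moreover have "4 * (a + 1) = 2 * real CARD('m)"
    by (simp add: a_def)
  ultimately show ?case
    unfolding W0 radial_mean_darboux [OF h 0] by (simp only: add_0 of_nat_0)
next
  case (Suc N)
  let ?W = "\<lambda>j. weighted_mean a n j h x t"
  have "((\<lambda>t. \<Sum>i\<in>Basis. weighted_mean a n N (partial_deriv i (partial_deriv i h)) x t) has_real_derivative
      (\<Sum>i\<in>Basis. 2 * t * ((real n - a) / t\<^sup>2 * weighted_mean a n N (partial_deriv i (partial_deriv i h)) x t + weighted_mean a n (Suc N) (partial_deriv i (partial_deriv i h)) x t))) (at t)"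
    using h Suc.prems by (intro DERIV_sum weighted_mean_DERIV_t smooth_fun_partial)
  moreover have "((\<lambda>t. \<Sum>i\<in>Basis. weighted_mean a n N (partial_deriv i (partial_deriv i h)) x t) has_real_derivative
      4 * (2 * t * ?W (N + 2) + 2 * t * ((real n - a) / t\<^sup>2 * ?W (N + 2) + ?W (N + 3)) * t\<^sup>2
       + (real N + 1 - a) * (2 * t * ((real n - a) / t\<^sup>2 * ?W (N + 1) + ?W (N + 2))))) (at t)"
  \<comment> \<open>The induction hypothesis holds at every nonzero radius, hence it may be
    differentiated.\<close>
  proof (rule has_real_derivative_cong_off_zero [OF _ Suc.prems Suc.IH])
    have t2: "((\<lambda>t. t\<^sup>2) has_real_derivative 2 * t) (at t)"
      by (auto intro!: derivative_eq_intros)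
    have eq: "Suc (N + 2) = N + 3" "Suc (N + 1) = N + 2" by auto
    show "((\<lambda>t. 4 * (t\<^sup>2 * weighted_mean a n (N + 2) h x t + (real N + 1 - a) * weighted_mean a n (N + 1) h x t)) has_real_derivative
      4 * (2 * t * ?W (N + 2) + 2 * t * ((real n - a) / t\<^sup>2 * ?W (N + 2) + ?W (N + 3)) * t\<^sup>2
       + (real N + 1 - a) * (2 * t * ((real n - a) / t\<^sup>2 * ?W (N + 1) + ?W (N + 2))))) (at t)"
      by (intro DERIV_cmult DERIV_add DERIV_mult t2 weighted_mean_DERIV_t [OF h Suc.prems, of a n "N + 2" x, unfolded eq]
          weighted_mean_DERIV_t [OF h Suc.prems, of a n "N + 1" x, unfolded eq])
  qed
  ultimately have "(\<Sum>i\<in>Basis. 2 * t * ((real n - a) / t\<^sup>2 * weighted_mean a n N (partial_deriv i (partial_deriv i h)) x t + weighted_mean a n (Suc N) (partial_deriv i (partial_deriv i h)) x t))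
     = 4 * (2 * t * ?W (N + 2) + 2 * t * ((real n - a) / t\<^sup>2 * ?W (N + 2) + ?W (N + 3)) * t\<^sup>2
       + (real N + 1 - a) * (2 * t * ((real n - a) / t\<^sup>2 * ?W (N + 1) + ?W (N + 2))))"
    by (rule DERIV_unique)
  also have "(\<Sum>i\<in>Basis. 2 * t * ((real n - a) / t\<^sup>2 * weighted_mean a n N (partial_deriv i (partial_deriv i h)) x t + weighted_mean a n (Suc N) (partial_deriv i (partial_deriv i h)) x t))
    = 2 * t * ((real n - a) / t\<^sup>2 * (\<Sum>i\<in>Basis. weighted_mean a n N (partial_deriv i (partial_deriv i h)) x t) + (\<Sum>i\<in>Basis. weighted_mean a n (Suc N) (partial_deriv i (partial_deriv i h)) x t))"
    by (simp add: sum_distrib_left sum.distrib ring_distribs)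
  finally have eq: "2 * t * ((real n - a) / t\<^sup>2 * (\<Sum>i\<in>Basis. weighted_mean a n N (partial_deriv i (partial_deriv i h)) x t) + (\<Sum>i\<in>Basis. weighted_mean a n (Suc N) (partial_deriv i (partial_deriv i h)) x t))
     = 4 * (2 * t * ?W (N + 2) + 2 * t * ((real n - a) / t\<^sup>2 * ?W (N + 2) + ?W (N + 3)) * t\<^sup>2
       + (real N + 1 - a) * (2 * t * ((real n - a) / t\<^sup>2 * ?W (N + 1) + ?W (N + 2))))" .
  define \<beta> c X where "\<beta> = (real n - a) / t\<^sup>2" and "c = real N + 1 - a"
    and "X = (\<Sum>i\<in>Basis. weighted_mean a n (Suc N) (partial_deriv i (partial_deriv i h)) x t)"
  have "2 * t * X = 2 * t * (4 * (?W (N + 2) + t\<^sup>2 * ?W (N + 3) + c * ?W (N + 2)))"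
    using eq unfolding Suc.IH [OF Suc.prems] \<beta>_def [symmetric] c_def [symmetric] X_def [symmetric]
    by (simp only: algebra_simps)
  then have "X = 4 * (?W (N + 2) + t\<^sup>2 * ?W (N + 3) + c * ?W (N + 2))"
    using Suc.prems by (subst (asm) mult_left_cancel) auto
  then show ?case
    by (simp add: X_def c_def numeral_3_eq_3 algebra_simps)
qed

section \<open>The Grassmann algebra\<close>

text \<open>The two position signs differ exactly by the generator k lying below k + 1, so their
  product is -1 whatever lies further down.\<close>

lemma gderiv_gderiv_Suc:
  "gderiv k (gderiv (Suc k) a) C = - (if {k, Suc k} \<inter> C = {} then a (C \<union> {k, Suc k}) else 0)"
proof (cases "{k, Suc k} \<inter> C = {}")
  case True
  have "{i \<in> insert k C. i < Suc k} = insert k {i \<in> C. i < k}"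
    using True by auto
  then have "card {i \<in> insert k C. i < Suc k} = Suc (card {i \<in> C. i < k})"
    by simp
  moreover have "insert (Suc k) (insert k C) = C \<union> {k, Suc k}"
    by auto
  ultimately show ?thesis
    using True by (simp add: gderiv_def power_add [symmetric] mult.assoc [symmetric])
next
  case False
  then show ?thesis
    by (auto simp: gderiv_def)
qed

lemma card_less_insert:
  fixes C :: "nat set"
  assumes "k \<notin> C"
  shows "card {i. (i = k \<or> i \<in> C) \<and> i < l} = card {i \<in> C. i < l} + (if k < l then 1 else 0)"
proof -
  have "{i. (i = k \<or> i \<in> C) \<and> i < l} = (if k < l then insert k {i \<in> C. i < l} else {i \<in> C. i < l})"
    by auto
  with assms show ?thesis by auto
qed

lemma gderiv_anticommute:
  assumes "k \<noteq> l"
  shows "gderiv k (gderiv l a) C = - gderiv l (gderiv k a) C"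
  using assms by (auto simp: gderiv_def card_less_insert insert_commute)

lemma gmul_gen:
  "gmul (gen k) b C = (if finite C \<and> k \<in> C then (-1) ^ card {i \<in> C. i < k} * b (C - {k}) else 0)"
proof (cases "finite C")
  case True
  have "gmul (gen k) b C = (\<Sum>A\<in>Pow C. if A = {k} then gsign {k} (C - {k}) * b (C - {k}) else 0)"
    unfolding gmul_def if_P [OF True] by (intro sum.cong) (auto simp: gen_def)
  also have "\<dots> = (if k \<in> C then gsign {k} (C - {k}) * b (C - {k}) else 0)"
    using True by (simp add: sum.delta)
  also have "gsign {k} (C - {k}) = (-1) ^ card {i \<in> C. i < k}"
  proof -
    have "{(i, j). i \<in> {k} \<and> j \<in> C - {k} \<and> j < i} = Pair k ` {i \<in> C. i < k}"
      by auto
    then show ?thesis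
      by (simp add: gsign_def card_image inj_on_def)
  qed
  finally show ?thesis
    using True by simp
qed (simp add: gmul_def)

lemma gmul_gadd_left: "gmul (gadd a b) c = gadd (gmul a c) (gmul b c)"
  by (auto simp: gmul_def gadd_def fun_eq_iff ring_distribs sum.distrib)

lemma gmul_gscale_left: "gmul (gscale r a) b = gscale r (gmul a b)"
  by (auto simp: gmul_def gscale_def fun_eq_iff sum_distrib_left mult_ac)

lemma gmul_sum_left: "gmul (\<lambda>C. \<Sum>k\<in>K. c k * u k C) b C = (\<Sum>k\<in>K. c k * gmul (u k) b C)"
proof -
  have "(\<Sum>A\<in>Pow C. gsign A (C - A) * (\<Sum>k\<in>K. c k * u k A) * b (C - A)) =
    (\<Sum>A\<in>Pow C. \<Sum>k\<in>K. c k * (gsign A (C - A) * u k A * b (C - A)))"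
    by (simp add: sum_distrib_left sum_distrib_right mult_ac)
  then show ?thesis
    by (simp add: gmul_def sum.swap [of _ K "Pow C"] sum_distrib_left)
qed

text \<open>The graded Leibniz rule for an odd generator. \<open>gmul\<close> vanishes on infinite
  index sets by definition, and the hypothesis makes the isolated term b do the same.\<close>

lemma gderiv_gmul_gen:
  assumes "\<And>C. infinite C \<Longrightarrow> b C = 0"
  shows "gderiv k (gmul (gen l) b) C = (if k = l then b C else 0) - gmul (gen l) (gderiv k b) C"
proof (cases "finite C")
  case False
  then show ?thesis using assms by (simp add: gderiv_def gmul_gen)
next
  case fin: True
  show ?thesis
  proof (cases "k = l")
    case True
    have sq: "(-1) ^ c * ((-1) ^ c * z) = z" for c and z :: real
      by (cases "even c") auto
    have "card {i \<in> C - {l}. i < l} = card {i \<in> C. i < l}" "card {i \<in> insert l C. i < l} = card {i \<in> C. i < l}"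
      by (auto intro!: arg_cong [where f = card])
    moreover have "insert l (C - {l}) = C" if "l \<in> C"
      using that by auto
    moreover have "insert l C - {l} = C" if "l \<notin> C"
      using that by auto
    ultimately have "gderiv l (gmul (gen l) b) C = b C - gmul (gen l) (gderiv l b) C"
      unfolding gderiv_def gmul_gen using fin by (cases "l \<in> C") (simp_all only: sq if_True if_False Diff_iff insert_iff
          simp_thms finite_insert diff_0_right cancel_comm_monoid_add_class.diff_cancel)
    then show ?thesis
      unfolding True by simp
  next
    case neq: False
    show ?thesis
    proof (cases "l \<in> C \<and> k \<notin> C")
      case True
      then obtain D where D: "C = insert l D" "l \<notin> D" "k \<notin> D"
        using mk_disjoint_insert [of l C] by auto
      have sets: "insert k (insert l D) - {l} = insert k D" "insert l D - {l} = D"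
        using D neq by auto
      have cards: "card {i \<in> insert l D. i < k} = card {i \<in> D. i < k} + (if l < k then 1 else 0)"
          "card {i \<in> insert k (insert l D). i < l} = card {i \<in> D. i < l} + (if k < l then 1 else 0)"
          "card {i \<in> insert l D. i < l} = card {i \<in> D. i < l}"
        using card_less_insert [of l D k] card_less_insert [of k "insert l D" l] card_less_insert [of l D l] D neq by auto
      show ?thesis
        unfolding gderiv_def gmul_gen D(1) sets cards using D neq fin by simp
    qed (use neq in \<open>auto simp: gderiv_def gmul_gen\<close>)
  qed
qed

lemma gsign_empty: "gsign {} B = 1"
  by (simp add: gsign_def)

text \<open>An element of D below one of the two adjacent generators is below both, so the pair adds
  an even number of inversions.\<close>

lemma gsign_adjacent_pair:
  assumes "finite B" "finite D" "{i, Suc i} \<inter> B = {}" "{i, Suc i} \<inter> D = {}"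
  shows "gsign (B \<union> {i, Suc i}) D = gsign B D"
proof -
  let ?S = "{(p, q). p \<in> B \<and> q \<in> D \<and> q < p}" and ?D = "{q \<in> D. q < i}"
  have eq: "{(p, q). p \<in> B \<union> {i, Suc i} \<and> q \<in> D \<and> q < p} = ?S \<union> (Pair i ` ?D \<union> Pair (Suc i) ` ?D)"
    using assms(4) by (auto simp: less_Suc_eq)
  have "?S \<subseteq> B \<times> D" by auto
  then have fin: "finite ?S"
    using assms finite_subset by blast
  have "card (?S \<union> (Pair i ` ?D \<union> Pair (Suc i) ` ?D)) = card ?S + (card ?D + card ?D)"
    using assms fin by (subst card_Un_disjoint card_image; (auto simp: inj_on_def)?)+
  then show ?thesis
    unfolding gsign_def eq by (simp add: power_add flip: mult_2)
qed

text \<open>The generators y`_(2k+1), y`_(2k+2) are adjacent, so multiplying or differentiating by such a pair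
  produces no position-dependent sign.\<close>

definition ypair :: "nat \<Rightarrow> nat \<Rightarrow> nat set" where
  "ypair n k = {2 * n + 2 * k, Suc (2 * n + 2 * k)}"

definition ygens :: "nat \<Rightarrow> nat set" where
  "ygens n = {2 * n..<4 * n}"

text \<open>Multiplication by \<open>theta2\<close> without signs; on finite index sets it agrees
  with \<open>gmul\<close> (see \<open>gmul_theta2\<close>).\<close>

definition theta_mul :: "nat \<Rightarrow> galg \<Rightarrow> galg" where
  "theta_mul n a = (\<lambda>C. - (\<Sum>k<n. if ypair n k \<subseteq> C then a (C - ypair n k) else 0))"

text \<open>The odd Laplacian on the pairs P k; its factor -4 became 4 by
  \<open>gderiv_gderiv_Suc\<close>. The pairs are a parameter so that the same operator can be taken
  in the odd x- and in the odd y-variables.\<close>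

definition pair_laplace :: "nat \<Rightarrow> (nat \<Rightarrow> nat set) \<Rightarrow> galg \<Rightarrow> galg" where
  "pair_laplace n P a = (\<lambda>C. 4 * (\<Sum>k<n. if P k \<inter> C = {} then a (C \<union> P k) else 0))"

lemma theta_mul_apply: "theta_mul n a C = - (\<Sum>k<n. if ypair n k \<subseteq> C then a (C - ypair n k) else 0)"
  by (simp add: theta_mul_def)

lemma theta_mul_pow_Suc:
  "(theta_mul n ^^ Suc j) a C = - (\<Sum>k<n. if ypair n k \<subseteq> C then (theta_mul n ^^ j) a (C - ypair n k) else 0)"
  by (subst funpow.simps, subst o_apply, subst theta_mul_apply, rule refl)

lemma gmul_gen_gen_Suc: "gmul (gen i) (gen (Suc i)) C = (if C = {i, Suc i} then 1 else 0)"
proof (cases "C = {i, Suc i}")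
  case True
  have eq: "{i, Suc i} - {i} = {Suc i}" "{j \<in> {i, Suc i}. j < i} = {}" by auto
  show ?thesis
    unfolding gmul_gen True eq by (simp add: gen_def)
next
  case False
  then have "\<not> (i \<in> C \<and> C - {i} = {Suc i})" by auto
  with False show ?thesis
    unfolding gmul_gen by (auto simp: gen_def)
qed

lemma theta2_eq: "theta2 n C = - (\<Sum>k<n. if C = ypair n k then 1 else 0)"
proof -
  have "gmul (yodd n (2 * k)) (yodd n (2 * k + 1)) C = (if C = ypair n k then 1 else 0)" for k
    using gmul_gen_gen_Suc [of "2 * n + 2 * k" C] by (simp add: yodd_def ypair_def)
  then show ?thesis
    by (simp add: theta2_def gscale_def)
qed

lemma gmul_theta2:
  assumes "finite C"
  shows "gmul (theta2 n) a C = theta_mul n a C"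
proof -
  have "gmul (theta2 n) a C = - (\<Sum>A\<in>Pow C. \<Sum>k<n. if A = ypair n k then gsign A (C - A) * a (C - A) else 0)"
    using assms by (simp add: gmul_def theta2_eq sum_distrib_left sum_distrib_right sum_negf [symmetric]
        if_distrib [where f = "\<lambda>z. z * _"] if_distrib [where f = "\<lambda>z. _ * z"] cong: if_cong)
  also have "\<dots> = - (\<Sum>k<n. \<Sum>A\<in>Pow C. if A = ypair n k then gsign A (C - A) * a (C - A) else 0)"
    by (subst sum.swap) simp
  also have "\<dots> = - (\<Sum>k<n. if ypair n k \<subseteq> C then gsign (ypair n k) (C - ypair n k) * a (C - ypair n k) else 0)"
    using assms by (simp add: sum.delta)
  also have "\<dots> = theta_mul n a C"
  proof -
    have "gsign (ypair n k) (C - ypair n k) = 1" for k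
      using gsign_adjacent_pair [of "{}" "C - ypair n k" "2 * n + 2 * k"] assms
      by (simp add: ypair_def gsign_empty)
    then show ?thesis
      by (simp add: theta_mul_def cong: if_cong)
  qed
  finally show ?thesis .
qed

lemma gmul_cong:
  assumes "\<And>A. A \<subseteq> C \<Longrightarrow> finite A \<Longrightarrow> a A = a' A" "\<And>A. A \<subseteq> C \<Longrightarrow> finite A \<Longrightarrow> b A = b' A"
  shows "gmul a b C = gmul a' b' C"
proof -
  have "a A = a' A" "b (C - A) = b' (C - A)" if "finite C" "A \<subseteq> C" for A
    using that finite_subset [OF that(2,1)] by (auto intro!: assms)
  then show ?thesis
    by (auto simp: gmul_def intro!: sum.cong)
qed

text \<open>Associativity with \<open>theta2\<close> as first factor. The sets A that contain a pair
  are reindexed by A minus the pair, which leaves \<open>gsign\<close> unchanged because the pair is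
  adjacent.\<close>

lemma gmul_theta_mul:
  assumes "finite C"
  shows "gmul (theta_mul n a) p C = theta_mul n (gmul a p) C"
proof -
  let ?P = "ypair n"
  have "gmul (theta_mul n a) p C =
      - (\<Sum>A\<in>Pow C. \<Sum>k<n. if ?P k \<subseteq> A then gsign A (C - A) * a (A - ?P k) * p (C - A) else 0)"
    using assms by (simp add: gmul_def theta_mul_def sum_distrib_left sum_distrib_right sum_negf [symmetric]
        if_distrib [where f = "\<lambda>z. z * _"] if_distrib [where f = "\<lambda>z. _ * z"] cong: if_cong)
  also have "\<dots> = - (\<Sum>k<n. \<Sum>A\<in>Pow C. if ?P k \<subseteq> A then gsign A (C - A) * a (A - ?P k) * p (C - A) else 0)"
    by (subst sum.swap) simp
  also have "\<dots> = - (\<Sum>k<n. if ?P k \<subseteq> C then gmul a p (C - ?P k) else 0)"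
  proof -
    have "(\<Sum>A\<in>Pow C. if ?P k \<subseteq> A then gsign A (C - A) * a (A - ?P k) * p (C - A) else 0)
        = (if ?P k \<subseteq> C then gmul a p (C - ?P k) else 0)" for k
    proof (cases "?P k \<subseteq> C")
      case False
      have "(\<Sum>A\<in>Pow C. if ?P k \<subseteq> A then gsign A (C - A) * a (A - ?P k) * p (C - A) else 0) = 0"
      proof (intro sum.neutral ballI)
        fix A
        assume "A \<in> Pow C"
        with False have "\<not> ?P k \<subseteq> A" by blast
        then show "(if ?P k \<subseteq> A then gsign A (C - A) * a (A - ?P k) * p (C - A) else 0) = 0" by simp
      qed
      with False show ?thesis by simp
    next
      case True
      have "(\<Sum>A\<in>Pow C. if ?P k \<subseteq> A then gsign A (C - A) * a (A - ?P k) * p (C - A) else 0)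
          = (\<Sum>A\<in>{A \<in> Pow C. ?P k \<subseteq> A}. gsign A (C - A) * a (A - ?P k) * p (C - A))"
        using assms by (intro sum.inter_filter [symmetric]) auto
      also have "\<dots> = (\<Sum>B\<in>Pow (C - ?P k). gsign B (C - ?P k - B) * a B * p (C - ?P k - B))"
      proof (rule sum.reindex_bij_witness [of _ "\<lambda>B. B \<union> ?P k" "\<lambda>A. A - ?P k"])
        fix A
        assume A: "A \<in> {A \<in> Pow C. ?P k \<subseteq> A}"
        then have "C - ?P k - (A - ?P k) = C - A" "A - ?P k \<union> ?P k = A"
          by auto
        moreover have "gsign (A - ?P k \<union> ?P k) (C - A) = gsign (A - ?P k) (C - A)"
          using A assms unfolding ypair_def
          by (intro gsign_adjacent_pair) (auto intro: finite_subset)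
        ultimately show "gsign (A - ?P k) (C - ?P k - (A - ?P k)) * a (A - ?P k) * p (C - ?P k - (A - ?P k))
            = gsign A (C - A) * a (A - ?P k) * p (C - A)"
          by simp
      qed (use True in auto)
      finally show ?thesis
        using True assms by (simp add: gmul_def)
    qed
    then show ?thesis by simp
  qed
  finally show ?thesis
    by (simp add: theta_mul_def)
qed

lemma theta_mul_cong:
  assumes "\<And>A. A \<subseteq> C \<Longrightarrow> a A = b A"
  shows "theta_mul n a C = theta_mul n b C"
  using assms by (auto simp: theta_mul_def intro!: sum.cong)

lemma theta_mul_pow_cong:
  assumes "\<And>A. A \<subseteq> C \<Longrightarrow> a A = b A"
  shows "(theta_mul n ^^ j) a C = (theta_mul n ^^ j) b C"
  using assms
proof (induction j arbitrary: C)
  case (Suc j)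
  then show ?case
    by (auto intro!: theta_mul_cong)
qed auto

lemma theta_mul_pow_sum:
  "(theta_mul n ^^ j) (\<lambda>C. \<Sum>i\<in>I. c i * u i C) C = (\<Sum>i\<in>I. c i * (theta_mul n ^^ j) (u i) C)"
proof (induction j arbitrary: C)
  case (Suc j)
  have "(theta_mul n ^^ Suc j) (\<lambda>C. \<Sum>i\<in>I. c i * u i C) C =
     theta_mul n (\<lambda>C. \<Sum>i\<in>I. c i * (theta_mul n ^^ j) (u i) C) C"
    by (simp, rule theta_mul_cong, rule Suc)
  also have "\<dots> = (\<Sum>i\<in>I. c i * (theta_mul n ^^ Suc j) (u i) C)"
  proof -
    have "(\<Sum>k<n. if ypair n k \<subseteq> C then \<Sum>i\<in>I. c i * (theta_mul n ^^ j) (u i) (C - ypair n k) else 0) =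
       (\<Sum>k<n. \<Sum>i\<in>I. c i * (if ypair n k \<subseteq> C then (theta_mul n ^^ j) (u i) (C - ypair n k) else 0))"
      by (intro sum.cong) auto
    also have "\<dots> = (\<Sum>i\<in>I. c i * (\<Sum>k<n. if ypair n k \<subseteq> C then (theta_mul n ^^ j) (u i) (C - ypair n k) else 0))"
      by (subst sum.swap) (simp add: sum_distrib_left)
    finally show ?thesis
      unfolding theta_mul_pow_Suc by (simp add: theta_mul_apply sum_negf)
  qed
  finally show ?case .
qed simp

lemma gmul_gone:
  assumes "finite C"
  shows "gmul gone p C = p C"
proof -
  have "gmul gone p C = (\<Sum>A\<in>Pow C. if A = {} then p C else 0)"
    unfolding gmul_def if_P [OF assms] by (intro sum.cong) (auto simp: gone_def gsign_empty)
  then show ?thesis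
    using assms by (simp add: sum.delta)
qed

lemma gmul_gpow_theta2:
  assumes "finite C"
  shows "gmul (gpow (theta2 n) j) p C = (theta_mul n ^^ j) p C"
  using assms
proof (induction j arbitrary: C)
  case 0
  then show ?case by (simp add: gmul_gone)
next
  case (Suc j)
  have "gmul (gpow (theta2 n) (Suc j)) p C = gmul (theta_mul n (gpow (theta2 n) j)) p C"
    by (rule gmul_cong) (simp_all add: gmul_theta2)
  also have "\<dots> = theta_mul n (gmul (gpow (theta2 n) j) p) C"
    by (rule gmul_theta_mul) fact
  also have "\<dots> = theta_mul n ((theta_mul n ^^ j) p) C"
    using Suc by (intro theta_mul_cong) (auto intro: finite_subset)
  finally show ?case by simp
qed

text \<open>On the unit sphere the factors 1/r^2 of the weight are 1, and the powers of theta^2 from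
  the weight and from the Taylor operator merge.\<close>

lemma gmul_sphere_weight_phi_sharp:
  fixes w :: "real^'m"
  assumes "finite C" "norm w = 1"
  shows "gmul (sphere_weight m n w) (phi_sharp n G w) C =
    (\<Sum>k\<le>n. \<Sum>j\<le>n. ((real m / 2 - 1) gchoose k) * (-1) ^ (k + j) / fact j *
      (theta_mul n ^^ (k + j)) ((radD ^^ j) G w) C)"
proof -
  have "gmul (sphere_weight m n w) (phi_sharp n G w) C =
      (\<Sum>k\<le>n. (((real m / 2 - 1) gchoose k) * (-1) ^ k) * gmul (gpow (theta2 n) k) (phi_sharp n G w) C)"
    unfolding sphere_weight_def by (simp add: assms gmul_sum_left [symmetric])
  also have "\<dots> = (\<Sum>k\<le>n. (((real m / 2 - 1) gchoose k) * (-1) ^ k) *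
      (theta_mul n ^^ k) (\<lambda>C. \<Sum>j\<le>n. ((-1) ^ j / fact j) * (theta_mul n ^^ j) ((radD ^^ j) G w) C) C)"
  proof -
    have "phi_sharp n G w D = (\<Sum>j\<le>n. ((-1) ^ j / fact j) * (theta_mul n ^^ j) ((radD ^^ j) G w) D)" if "D \<subseteq> C" for D
      by (simp add: phi_sharp_def gmul_gpow_theta2 finite_subset [OF that assms(1)])
    then show ?thesis
      unfolding gmul_gpow_theta2 [OF assms(1)]
      by (intro sum.cong refl arg_cong2 [where f = times] theta_mul_pow_cong)
  qed
  also have "\<dots> = (\<Sum>k\<le>n. \<Sum>j\<le>n. ((real m / 2 - 1) gchoose k) * (-1) ^ (k + j) / fact j *
      (theta_mul n ^^ (k + j)) ((radD ^^ j) G w) C)"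
    unfolding theta_mul_pow_sum by (simp add: sum_distrib_left power_add funpow_add mult_ac)
  finally show ?thesis .
qed

section \<open>The Berezin integral\<close>

lemma bz_iter_eq:
  "bz_iter n k a C = (if C \<inter> {2 * n..<2 * n + k} = {}
    then (-1) ^ (k * card {i \<in> C. i < 2 * n}) * a (C \<union> {2 * n..<2 * n + k}) else 0)"
proof (induction k arbitrary: C)
  case (Suc k)
  have ivl: "{2 * n..<2 * n + Suc k} = insert (2 * n + k) {2 * n..<2 * n + k}"
    by auto
  show ?case
  proof (cases "C \<inter> {2 * n..<2 * n + Suc k} = {}")
    case True
    then have "{i \<in> C. i < 2 * n + k} = {i \<in> C. i < 2 * n}"
        "{i \<in> insert (2 * n + k) C. i < 2 * n} = {i \<in> C. i < 2 * n}"
        "2 * n + k \<notin> C" "insert (2 * n + k) C \<inter> {2 * n..<2 * n + k} = {}"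
        "insert (2 * n + k) C \<union> {2 * n..<2 * n + k} = C \<union> {2 * n..<2 * n + Suc k}"
      unfolding ivl by auto
    with True show ?thesis
      by (simp add: gderiv_def Suc power_add)
  next
    case False
    then have "2 * n + k \<notin> C \<Longrightarrow> insert (2 * n + k) C \<inter> {2 * n..<2 * n + k} \<noteq> {}"
      unfolding ivl by auto
    with False show ?thesis
      by (auto simp: gderiv_def Suc)
  qed
qed auto

text \<open>By \<open>bz_iter_eq\<close> each derivative contributes the sign of the generators of C
  below \<open>2 * n\<close>. There are \<open>2 * n\<close> derivatives, an even number, so these
  signs cancel.\<close>

lemma berezin_eq: "berezin n a C = (if C \<inter> ygens n = {} then a (C \<union> ygens n) / pi ^ n else 0)"
proof -
  have "2 * n + 2 * n = 4 * n" by simp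
  then show ?thesis
    by (simp add: berezin_def gscale_def bz_iter_eq ygens_def power_mult)
qed

section \<open>Degree in the y-generators and commutation with the odd Laplacian\<close>

lemma ygens_eq: "ygens n = (\<Union>k<n. ypair n k)"
proof
  show "ygens n \<subseteq> (\<Union>k<n. ypair n k)"
  proof
    fix i
    assume "i \<in> ygens n"
    then have "i \<in> ypair n ((i - 2 * n) div 2)" "(i - 2 * n) div 2 < n"
      by (auto simp: ygens_def ypair_def)
    then show "i \<in> (\<Union>k<n. ypair n k)" by blast
  qed
qed (auto simp: ygens_def ypair_def)

lemma ypair_disjoint: "k \<noteq> l \<Longrightarrow> ypair n k \<inter> ypair n l = {}"
  by (auto simp: ypair_def)

lemma finite_ypair [simp]: "finite (ypair n k)" and card_ypair: "card (ypair n k) = 2"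
  by (auto simp: ypair_def)

lemma card_Diff_ypair:
  assumes "k < n" "ypair n k \<subseteq> C"
  shows "card (C \<inter> ygens n) = card ((C - ypair n k) \<inter> ygens n) + 2"
proof -
  have "C \<inter> ygens n = ((C - ypair n k) \<inter> ygens n) \<union> ypair n k"
    using assms by (auto simp: ygens_eq)
  moreover have "card (((C - ypair n k) \<inter> ygens n) \<union> ypair n k) = card ((C - ypair n k) \<inter> ygens n) + card (ypair n k)"
    by (rule card_Un_disjoint) (auto simp: ygens_def)
  ultimately show ?thesis by (simp add: card_ypair)
qed

text \<open>Each factor theta^2 uses up a pair of the y-generators in C.\<close>

lemma theta_mul_pow_eq_0:
  assumes "card (C \<inter> ygens n) < 2 * N"
  shows "(theta_mul n ^^ N) a C = 0"
  using assms
proof (induction N arbitrary: C)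
  case (Suc N)
  have "(theta_mul n ^^ N) a (C - ypair n k) = 0" if "k < n" "ypair n k \<subseteq> C" for k
    using Suc card_Diff_ypair [OF that] by simp
  then show ?case
    unfolding theta_mul_pow_Suc by (simp cong: if_cong)
qed simp

text \<open>Homogeneity: theta^2 has degree 2 in the y-generators. Both powers of l are multiplied
  out, so that no division occurs.\<close>

lemma theta_mul_pow_scale:
  "l ^ (2 * N) * (theta_mul n ^^ N) (\<lambda>C. l ^ card (C \<inter> ygens n) * a C) C
    = l ^ card (C \<inter> ygens n) * (theta_mul n ^^ N) a C"
proof (induction N arbitrary: C)
  case (Suc N)
  let ?b = "\<lambda>C. l ^ card (C \<inter> ygens n) * a C"
  have step: "l ^ (2 * Suc N) * (if ypair n k \<subseteq> C then (theta_mul n ^^ N) ?b (C - ypair n k) else 0)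
      = l ^ card (C \<inter> ygens n) * (if ypair n k \<subseteq> C then (theta_mul n ^^ N) a (C - ypair n k) else 0)"
    if "k < n" for k
    using Suc [of "C - ypair n k"] card_Diff_ypair [OF that] by (simp add: power_add power2_eq_square mult_ac)
  have "(\<Sum>k<n. l ^ (2 * Suc N) * (if ypair n k \<subseteq> C then (theta_mul n ^^ N) ?b (C - ypair n k) else 0))
      = (\<Sum>k<n. l ^ card (C \<inter> ygens n) * (if ypair n k \<subseteq> C then (theta_mul n ^^ N) a (C - ypair n k) else 0))"
    by (intro sum.cong refl step) simp
  then show ?case
    by (simp only: theta_mul_pow_Suc mult_minus_right sum_distrib_left)
qed simp

text \<open>Multiplication by theta^2 raises the y-degree by 2, so an affine function of the degree
  is shifted by 2 when it is moved past it. This drives the induction for powers of theta^2.\<close>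

lemma theta_mul_affine:
  "theta_mul n (\<lambda>C. f C + c * (real (card (C \<inter> ygens n)) - e) * b C) C
    = theta_mul n f C + c * (real (card (C \<inter> ygens n)) - 2 - e) * theta_mul n b C"
proof -
  have "(\<Sum>k<n. if ypair n k \<subseteq> C then f (C - ypair n k) +
       c * (real (card ((C - ypair n k) \<inter> ygens n)) - e) * b (C - ypair n k) else 0)
    = (\<Sum>k<n. (if ypair n k \<subseteq> C then f (C - ypair n k) else 0) +
       c * (real (card (C \<inter> ygens n)) - 2 - e) * (if ypair n k \<subseteq> C then b (C - ypair n k) else 0))"
    by (intro sum.cong refl) (auto simp: card_Diff_ypair)
  then show ?thesis
    by (simp add: theta_mul_def sum.distrib sum_distrib_left)
qed

text \<open>A pair meets C in 2, 1 or 0 elements; one less than that is 1, 0 or -1. The two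
  indicators on the right are the diagonal terms of the commutator below.\<close>

lemma card_ygens: "real (card (C \<inter> ygens n)) - real n =
   (\<Sum>k<n. (if ypair n k \<subseteq> C then 1 else 0) - (if ypair n k \<inter> C = {} then 1 else 0))"
proof -
  have "card (C \<inter> ygens n) = card (\<Union>k<n. C \<inter> ypair n k)"
    by (simp add: ygens_eq)
  also have "\<dots> = (\<Sum>k<n. card (C \<inter> ypair n k))"
    by (rule card_UN_disjoint) (use ypair_disjoint in auto)
  finally have "real (card (C \<inter> ygens n)) - real n = (\<Sum>k<n. real (card (C \<inter> ypair n k)) - 1)"
    by (simp add: sum_subtractf)
  also have "\<dots> = (\<Sum>k<n. (if ypair n k \<subseteq> C then 1 else 0) - (if ypair n k \<inter> C = {} then 1 else 0))"
    by (intro sum.cong refl) (auto simp: ypair_def Int_insert_right)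
  finally show ?thesis .
qed

text \<open>The sl(2) relation between the odd Laplacian and multiplication by theta^2.\<close>

lemma pair_laplace_theta_mul:
  "pair_laplace n (ypair n) (theta_mul n a) C = theta_mul n (pair_laplace n (ypair n) a) C
    + 4 * (real (card (C \<inter> ygens n)) - real n) * a C"
proof -
  let ?P = "ypair n"
  let ?A = "\<lambda>k l. if ?P k \<inter> C = {} then (if ?P l \<subseteq> C \<union> ?P k then a (C \<union> ?P k - ?P l) else 0) else 0"
  let ?B = "\<lambda>k l. if ?P l \<subseteq> C then (if ?P k \<inter> (C - ?P l) = {} then a ((C - ?P l) \<union> ?P k) else 0) else 0"
  have "pair_laplace n ?P (theta_mul n a) C = - 4 * (\<Sum>k<n. \<Sum>l<n. ?A k l)"
    by (auto simp: pair_laplace_def theta_mul_def sum_negf [symmetric] intro!: sum.cong)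
  moreover have "theta_mul n (pair_laplace n ?P a) C = - 4 * (\<Sum>l<n. \<Sum>k<n. ?B k l)"
  proof -
    have "(\<Sum>l<n. if ?P l \<subseteq> C then pair_laplace n ?P a (C - ?P l) else 0) = (\<Sum>l<n. 4 * (\<Sum>k<n. ?B k l))"
      by (intro sum.cong refl) (simp add: pair_laplace_def)
    then show ?thesis
      by (simp only: theta_mul_apply sum_distrib_left [symmetric])
  qed
  moreover have "(\<Sum>l<n. \<Sum>k<n. ?B k l) = (\<Sum>k<n. \<Sum>l<n. ?B k l)"
    by (rule sum.swap)
  moreover have "(\<Sum>k<n. \<Sum>l<n. ?B k l) - (\<Sum>k<n. \<Sum>l<n. ?A k l) = (real (card (C \<inter> ygens n)) - real n) * a C"
  proof -
    \<comment> \<open>Removing one pair and inserting a different one commute, so only the diagonal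
      terms survive in the commutator.\<close>
    have "?B k l - ?A k l = (if l = k then ((if ?P k \<subseteq> C then 1 else 0) - (if ?P k \<inter> C = {} then 1 else 0)) * a C else 0)" for k l
    proof (cases "l = k")
      case True
      have "C - ?P k \<union> ?P k = C" if "?P k \<subseteq> C" using that by auto
      moreover have "C \<union> ?P k - ?P k = C" if "?P k \<inter> C = {}" using that by auto
      ultimately show ?thesis using True by auto
    next
      case False
      then have d: "?P k \<inter> ?P l = {}" using ypair_disjoint by blast
      then have "?P k \<inter> (C - ?P l) = {} \<longleftrightarrow> ?P k \<inter> C = {}" "?P l \<subseteq> C \<union> ?P k \<longleftrightarrow> ?P l \<subseteq> C"
          "C - ?P l \<union> ?P k = C \<union> ?P k - ?P l"
        by auto
      then show ?thesis using False by simp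
    qed
    then show ?thesis
      by (simp add: sum_subtractf [symmetric] card_ygens sum_distrib_right)
  qed
  ultimately show ?thesis
    by (simp add: algebra_simps)
qed

text \<open>The Laplacian is moved past the N factors one at a time. With d the y-degree, the j-th
  commutator contributes 4(d - 2j - n), and the sum over j < N is 4 N (d - (N - 1) - n).\<close>

lemma pair_laplace_theta_mul_pow:
  "pair_laplace n (ypair n) ((theta_mul n ^^ N) a) C = (theta_mul n ^^ N) (pair_laplace n (ypair n) a) C
    + 4 * real N * (real (card (C \<inter> ygens n)) - (real N - 1 + real n)) * (theta_mul n ^^ (N - 1)) a C"
proof (induction N arbitrary: C)
  case (Suc N)
  let ?d = "real (card (C \<inter> ygens n))"
  have "pair_laplace n (ypair n) ((theta_mul n ^^ Suc N) a) C =
      theta_mul n (pair_laplace n (ypair n) ((theta_mul n ^^ N) a)) C + 4 * (?d - real n) * (theta_mul n ^^ N) a C"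
    by (simp add: pair_laplace_theta_mul)
  also have "theta_mul n (pair_laplace n (ypair n) ((theta_mul n ^^ N) a)) C =
      (theta_mul n ^^ Suc N) (pair_laplace n (ypair n) a) C
      + 4 * real N * (?d - 2 - (real N - 1 + real n)) * theta_mul n ((theta_mul n ^^ (N - 1)) a) C"
    unfolding Suc by (simp add: theta_mul_affine)
  \<comment> \<open>For N = 0 the exponent \<open>N - 1\<close> is truncated, but the factor N
    vanishes.\<close>
  also have "4 * real N * (?d - 2 - (real N - 1 + real n)) * theta_mul n ((theta_mul n ^^ (N - 1)) a) C
      = 4 * real N * (?d - 2 - (real N - 1 + real n)) * (theta_mul n ^^ N) a C"
    by (cases N) auto
  finally show ?case
    by (simp add: algebra_simps)
qed simp

text \<open>Pairs of other generators neither block nor complete a y-pair, so inserting them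
  commutes with removing y-pairs.\<close>

lemma pair_laplace_theta_mul_disjoint:
  assumes "\<And>k l. k < n \<Longrightarrow> l < n \<Longrightarrow> P k \<inter> ypair n l = {}"
  shows "pair_laplace n P ((theta_mul n ^^ N) a) C = (theta_mul n ^^ N) (pair_laplace n P a) C"
proof (induction N arbitrary: C)
  case (Suc N)
  have step: "pair_laplace n P (theta_mul n b) C = theta_mul n (pair_laplace n P b) C" for b C
  proof -
    let ?Y = "ypair n"
    let ?A = "\<lambda>k l. if P k \<inter> C = {} then (if ?Y l \<subseteq> C \<union> P k then b (C \<union> P k - ?Y l) else 0) else 0"
    let ?B = "\<lambda>k l. if ?Y l \<subseteq> C then (if P k \<inter> (C - ?Y l) = {} then b ((C - ?Y l) \<union> P k) else 0) else 0"
    have "?A k l = ?B k l" if "k < n" "l < n" for k l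
    proof -
      have "P k \<inter> (C - ?Y l) = {} \<longleftrightarrow> P k \<inter> C = {}" "?Y l \<subseteq> C \<union> P k \<longleftrightarrow> ?Y l \<subseteq> C"
          "C - ?Y l \<union> P k = C \<union> P k - ?Y l"
        using assms [OF that] by auto
      then show ?thesis by simp
    qed
    then have "(\<Sum>k<n. \<Sum>l<n. ?A k l) = (\<Sum>k<n. \<Sum>l<n. ?B k l)"
      by (intro sum.cong refl) auto
    also have "\<dots> = (\<Sum>l<n. \<Sum>k<n. ?B k l)"
      by (rule sum.swap)
    moreover have "pair_laplace n P (theta_mul n b) C = - 4 * (\<Sum>k<n. \<Sum>l<n. ?A k l)"
      by (auto simp: pair_laplace_def theta_mul_def sum_negf [symmetric] intro!: sum.cong)
    moreover have "theta_mul n (pair_laplace n P b) C = - 4 * (\<Sum>l<n. \<Sum>k<n. ?B k l)"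
    proof -
      have "(\<Sum>l<n. if ?Y l \<subseteq> C then pair_laplace n P b (C - ?Y l) else 0) = (\<Sum>l<n. 4 * (\<Sum>k<n. ?B k l))"
        by (intro sum.cong refl) (simp add: pair_laplace_def)
      then show ?thesis
        by (simp only: theta_mul_apply sum_distrib_left [symmetric])
    qed
    ultimately show ?thesis by simp
  qed
  have "pair_laplace n P ((theta_mul n ^^ Suc N) a) C = theta_mul n (pair_laplace n P ((theta_mul n ^^ N) a)) C"
    by (simp add: step)
  also have "\<dots> = (theta_mul n ^^ Suc N) (pair_laplace n P a) C"
    unfolding Suc [abs_def] by simp
  finally show ?case .
qed simp

lemma pair_laplace_gderiv:
  "pair_laplace n (\<lambda>k. {c + 2 * k, Suc (c + 2 * k)}) a C = - 4 * (\<Sum>k<n. gderiv (c + 2 * k) (gderiv (c + 2 * k + 1) a) C)"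
  using gderiv_gderiv_Suc by (simp add: pair_laplace_def sum_negf)

section \<open>The odd monomials of the shifted argument\<close>

definition oddprod_list :: "nat \<Rightarrow> real \<Rightarrow> nat list \<Rightarrow> galg" where
  "oddprod_list n L is = foldr (\<lambda>i acc. gmul (gadd (gen i) (gscale L (gen (2 * n + i)))) acc) is gone"

lemma oddprod_list_Cons:
  "oddprod_list n L (i # is) = gadd (gmul (gen i) (oddprod_list n L is)) (gscale L (gmul (gen (2 * n + i)) (oddprod_list n L is)))"
  by (simp add: oddprod_list_def gmul_gadd_left gmul_gscale_left)

lemma oddprod_list_infinite: "infinite C \<Longrightarrow> oddprod_list n L is C = 0"
  by (cases "is") (auto simp: oddprod_list_def gone_def gmul_def)

text \<open>The parameter L accompanies exactly the y-generators. The bound on the indices keeps the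
  x-generators of the list out of \<open>ygens n\<close>.\<close>

lemma oddprod_list_scale:
  assumes "\<And>i. i \<in> set is \<Longrightarrow> i < 2 * n"
  shows "oddprod_list n L is C = L ^ card (C \<inter> ygens n) * oddprod_list n 1 is C"
  using assms
proof (induction "is" arbitrary: C)
  case Nil
  show ?case by (simp add: oddprod_list_def gone_def)
next
  case (Cons i "is")
  have i: "i \<notin> ygens n" "2 * n + i \<in> ygens n"
    using Cons.prems [of i] by (auto simp: ygens_def)
  have 1: "(C - {i}) \<inter> ygens n = C \<inter> ygens n"
    using i by auto
  have 2: "card (C \<inter> ygens n) = Suc (card ((C - {2 * n + i}) \<inter> ygens n))" if "2 * n + i \<in> C"
  proof -
    have "C \<inter> ygens n = insert (2 * n + i) ((C - {2 * n + i}) \<inter> ygens n)"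
      using i that by auto
    then have "card (C \<inter> ygens n) = card (insert (2 * n + i) ((C - {2 * n + i}) \<inter> ygens n))"
      by simp
    also have "\<dots> = Suc (card ((C - {2 * n + i}) \<inter> ygens n))"
      by (rule card_insert_disjoint) (auto simp: ygens_def)
    finally show ?thesis .
  qed
  have IH: "oddprod_list n L is D = L ^ card (D \<inter> ygens n) * oddprod_list n 1 is D" for D
    using Cons by simp
  show ?case
    unfolding oddprod_list_Cons gadd_def gscale_def gmul_gen IH [of "C - {i}"] IH [of "C - {2 * n + i}"] 1
    by (auto simp: 2 algebra_simps)
qed

text \<open>At L = 1 the product depends only on the sums of corresponding x- and y-generators, so
  the derivatives in the two variables agree.\<close>

lemma gderiv_oddprod_list:
  assumes "\<And>i. i \<in> set is \<Longrightarrow> i < 2 * n" "k < 2 * n"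
  shows "gderiv k (oddprod_list n 1 is) = gderiv (2 * n + k) (oddprod_list n 1 is)"
  using assms(1)
proof (induction "is")
  case Nil
  show ?case by (simp add: oddprod_list_def gderiv_def gone_def fun_eq_iff)
next
  case (Cons i "is")
  have lin: "gderiv k (gadd a (gscale 1 b)) C = gderiv k a C + gderiv k b C" for k a b C
    by (simp add: gderiv_def gadd_def gscale_def ring_distribs)
  have "i < 2 * n" "gderiv k (oddprod_list n 1 is) = gderiv (2 * n + k) (oddprod_list n 1 is)"
    using Cons by simp_all
  then show ?case
    using assms(2) unfolding oddprod_list_Cons
    by (intro ext) (simp add: lin gderiv_gmul_gen [OF oddprod_list_infinite])
qed

lemma oddprod_eq_list: "oddprod n L A = oddprod_list n L (sorted_list_of_set A)"
  by (simp add: oddprod_def oddprod_list_def xodd_def yodd_def)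

lemma pair_laplace_oddprod:
  assumes "A \<subseteq> {..<2 * n}"
  shows "pair_laplace n (\<lambda>k. {2 * k, Suc (2 * k)}) (oddprod n 1 A) = pair_laplace n (ypair n) (oddprod n 1 A)"
proof
  fix C
  let ?p = "oddprod n 1 A"
  have A: "i < 2 * n" if "i \<in> set (sorted_list_of_set A)" for i
    using that assms finite_subset [OF assms] by auto
  have "gderiv (2 * k) (gderiv (2 * k + 1) ?p) C = gderiv (2 * n + 2 * k) (gderiv (2 * n + 2 * k + 1) ?p) C" if "k < n" for k
  proof -
    have g: "gderiv i ?p = gderiv (2 * n + i) ?p" if "i < 2 * n" for i
      unfolding oddprod_eq_list by (rule gderiv_oddprod_list [OF A that])
    \<comment> \<open>The exchange of variables applies only to a derivative acting directly on the
      product. Anticommuting brings the second derivative inside, and anticommuting back cancels the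
      sign.\<close>
    have "gderiv (2 * k) (gderiv (2 * k + 1) ?p) C = gderiv (2 * k) (gderiv (2 * n + (2 * k + 1)) ?p) C"
      using that by (subst g) auto
    also have "\<dots> = - gderiv (2 * n + (2 * k + 1)) (gderiv (2 * k) ?p) C"
      using that by (intro gderiv_anticommute) auto
    also have "\<dots> = - gderiv (2 * n + (2 * k + 1)) (gderiv (2 * n + 2 * k) ?p) C"
      using that by (subst g) auto
    also have "\<dots> = gderiv (2 * n + 2 * k) (gderiv (2 * n + (2 * k + 1)) ?p) C"
      by (subst gderiv_anticommute) auto
    finally show ?thesis by (simp add: add.assoc)
  qed
  then show "pair_laplace n (\<lambda>k. {2 * k, Suc (2 * k)}) ?p C = pair_laplace n (ypair n) ?p C"
    using pair_laplace_gderiv [of n 0 ?p C] pair_laplace_gderiv [of n "2 * n" ?p C]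
    by (simp add: ypair_def [abs_def])
qed

text \<open>Integration by parts: a y-derivative has no component along all y-generators, so the
  y-Laplacian of theta^(2N) times the product vanishes at this index set. The commutator formula at
  y-degree \<open>2 * n\<close> then gives the constant.\<close>

lemma pair_laplace_berezin_coeff:
  assumes A: "A \<subseteq> {..<2 * n}" and C: "C \<inter> ygens n = {}"
  shows "pair_laplace n (\<lambda>k. {2 * k, Suc (2 * k)}) ((theta_mul n ^^ N) (oddprod n 1 A)) (C \<union> ygens n)
    = 4 * real N * (real N - 1 - real n) * (theta_mul n ^^ (N - 1)) (oddprod n 1 A) (C \<union> ygens n)"
proof -
  let ?p = "oddprod n 1 A" and ?D = "C \<union> ygens n"
  have "pair_laplace n (\<lambda>k. {2 * k, Suc (2 * k)}) ((theta_mul n ^^ N) ?p) ?D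
      = (theta_mul n ^^ N) (pair_laplace n (ypair n) ?p) ?D"
    unfolding pair_laplace_oddprod [OF A, symmetric]
    by (rule pair_laplace_theta_mul_disjoint) (auto simp: ypair_def)
  moreover have "ypair n k \<inter> ?D \<noteq> {}" if "k < n" for k
    using that by (auto simp: ygens_eq ypair_def)
  then have "pair_laplace n (ypair n) ((theta_mul n ^^ N) ?p) ?D = 0"
    by (simp add: pair_laplace_def)
  moreover have "?D \<inter> ygens n = ygens n" "card (ygens n) = 2 * n"
    by (auto simp: ygens_def)
  ultimately show ?thesis
    using pair_laplace_theta_mul_pow [of n N ?p ?D] by (simp add: algebra_simps)
qed

section \<open>The super spherical mean\<close>

text \<open>Along a ray the coefficients depend on the radius t through L t, and d/d(t^2) = L^2
  d/d((L t)^2); hence the factor \<open>L ^ (2 * j)\<close>.\<close>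

lemma radD_pow_shifted:
  fixes f :: "nat set \<Rightarrow> real^'m \<Rightarrow> real"
  assumes f: "superfun n f" and L: "L \<noteq> 0" and y: "y \<noteq> 0"
  shows "(radD ^^ j) (shifted n f x L) y C =
    (\<Sum>A\<in>Pow {..<2*n}. (L ^ (2 * j) * radial_deriv j (f A) x (L * norm y) (y /\<^sub>R norm y)) * oddprod n L A C)"
  using y
proof (induction j arbitrary: y C)
  case 0
  then have eq: "(L * norm y) *\<^sub>R (y /\<^sub>R norm y) = L *\<^sub>R y"
    by simp
  show ?case
    unfolding funpow_0 shifted_def radial_deriv.simps eq by simp
next
  case (Suc j)
  define u where "u = y /\<^sub>R norm y"
  have u: "norm u = 1" "y \<noteq> 0" and r: "norm y > 0"
    using Suc.prems by (auto simp: u_def)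
  have smooth: "smooth_fun (f A)" for A
    using f by (simp add: superfun_def)
  let ?S = "\<lambda>t. \<Sum>A\<in>Pow {..<2*n}. (L ^ (2 * j) * radial_deriv j (f A) x (L * t) u) * oddprod n L A C"
  have "((\<lambda>t. radial_deriv j (f A) x (L * t) u) has_real_derivative
      (2 * (L * norm y) * radial_deriv (Suc j) (f A) x (L * norm y) u) * L) (at (norm y))" for A
    using r L by (intro DERIV_chain2 [OF radial_deriv_DERIV_t [OF smooth]]) (auto intro!: derivative_eq_intros)
  then have "(?S has_real_derivative (\<Sum>A\<in>Pow {..<2*n}. (L ^ (2 * j) *
      ((2 * (L * norm y) * radial_deriv (Suc j) (f A) x (L * norm y) u) * L)) * oddprod n L A C)) (at (norm y))"
    by (intro DERIV_sum DERIV_cmult DERIV_cmult_right)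
  then have "((\<lambda>t. (radD ^^ j) (shifted n f x L) (t *\<^sub>R u) C) has_real_derivative
      (\<Sum>A\<in>Pow {..<2*n}. (L ^ (2 * j) *
      ((2 * (L * norm y) * radial_deriv (Suc j) (f A) x (L * norm y) u) * L)) * oddprod n L A C)) (at (norm y))"
  \<comment> \<open>On the positive half-line \<open>t *\<^sub>R u\<close> has norm t and direction
    u, so the induction hypothesis applies along the same ray.\<close>
  proof (rule has_field_derivative_transform_within_open [of _ _ _ "{0<..}"])
    fix t :: real
    assume "t \<in> {0<..}"
    then have "t *\<^sub>R u \<noteq> 0" "norm (t *\<^sub>R u) = t" "(t *\<^sub>R u) /\<^sub>R t = u"
      using u by auto
    then show "?S t = (radD ^^ j) (shifted n f x L) (t *\<^sub>R u) C"
      using Suc.IH [of "t *\<^sub>R u" C] by simp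
  qed (use r in auto)
  then have "(radD ^^ Suc j) (shifted n f x L) y C = 1 / (2 * norm y) * (\<Sum>A\<in>Pow {..<2*n}. (L ^ (2 * j) *
      ((2 * (L * norm y) * radial_deriv (Suc j) (f A) x (L * norm y) u) * L)) * oddprod n L A C)"
    by (simp add: radD_def DERIV_imp_deriv del: radial_deriv.simps flip: u_def)
  then show ?case
    using r by (simp add: sum_distrib_left u_def mult_ac del: radial_deriv.simps)
qed

lemma sum_square_triangle:
  fixes h :: "nat \<Rightarrow> nat \<Rightarrow> real"
  assumes "\<And>k j. k + j > n \<Longrightarrow> h k j = 0"
  shows "(\<Sum>k\<le>n. \<Sum>j\<le>n. h k j) = (\<Sum>N\<le>n. \<Sum>k\<le>N. h k (N - k))"
proof -
  have nz: "k + j \<le> n" if "h k j \<noteq> 0" for k j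
    using assms that not_le by blast
  have "(\<Sum>k\<le>n. \<Sum>j\<le>n. h k j) = (\<Sum>(k, j)\<in>{..n} \<times> {..n}. h k j)"
    by (rule sum.cartesian_product)
  also have "\<dots> = (\<Sum>(k, j)\<in>{(k, j). k + j \<le> n}. h k j)"
    by (rule sum.mono_neutral_right) (use nz in auto)
  also have "\<dots> = (\<Sum>N\<le>n. \<Sum>k\<le>N. h k (N - k))"
    by (rule sum.triangle_reindex_eq)
  finally show ?thesis .
qed

text \<open>The Berezin integral of (-theta^2)^N / N! times the odd monomial at L = 1.\<close>

definition mean_coeff :: "nat \<Rightarrow> nat set \<Rightarrow> nat \<Rightarrow> galg" where
  "mean_coeff n A N C = (if finite C \<and> C \<inter> ygens n = {}
    then (-1) ^ N / fact N * (theta_mul n ^^ N) (oddprod n 1 A) (C \<union> ygens n) / pi ^ n else 0)"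

text \<open>The Grassmann part and the analytic part separate: \<open>mean_coeff\<close> depends on
  neither x nor L. Its 1/N! is balanced by the \<open>fact N\<close> in
  \<open>weighted_mean\<close>, which makes the latter a genuine N-th derivative.\<close>

lemma spherical_mean_eq:
  fixes f :: "nat set \<Rightarrow> real^'m \<Rightarrow> real"
  assumes f: "superfun n f" and L: "L \<noteq> 0"
  shows "spherical_mean n f x L C =
    (\<Sum>A\<in>Pow {..<2*n}. \<Sum>N\<le>n. mean_coeff n A N C * weighted_mean (real CARD('m) / 2 - 1) n N (f A) x L)"
proof -
  define a where "a = real CARD('m) / 2 - 1"
  let ?g = "\<lambda>w. berezin n (gmul (sphere_weight CARD('m) n w) (phi_sharp n (shifted n f x L) w)) C"
  let ?D = "C \<union> ygens n"
  have mean: "spherical_mean n f x L C = surface_int ?g"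
    by (simp add: spherical_mean_def supersphere_int_def sphere_int_def surface_int_def)
  show ?thesis
  proof (cases "finite C \<and> C \<inter> ygens n = {}")
    case False
    then have "?g w = 0" for w
      by (auto simp: berezin_eq gmul_def)
    then have "spherical_mean n f x L C = 0"
      unfolding mean by (simp add: surface_int_def)
    moreover have "mean_coeff n A N C = 0" for A N
      using False by (auto simp: mean_coeff_def)
    ultimately show ?thesis
      by simp
  next
    case True
    then have finD: "finite ?D" and interD: "?D \<inter> ygens n = ygens n" and cardD: "card (?D \<inter> ygens n) = 2 * n"
      by (auto simp: ygens_def Int_absorb1)
    have smooth: "smooth_fun (f A)" for A
      using f by (simp add: superfun_def)
    define \<kappa> where "\<kappa> = (\<lambda>A N. (theta_mul n ^^ N) (oddprod n 1 A) ?D)"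
    have \<kappa>_0: "\<kappa> A N = 0" if "N > n" for A N
      unfolding \<kappa>_def using that cardD by (intro theta_mul_pow_eq_0) simp
    \<comment> \<open>The coefficient at \<open>?D\<close> has full y-degree \<open>2 * n\<close>,
      of which theta^(2N) supplies 2N; the remaining y-generators come from the odd product, each
      with a factor L.\<close>
    have \<kappa>_scale: "L ^ (2 * N) * (theta_mul n ^^ N) (oddprod n L A) ?D = L ^ (2 * n) * \<kappa> A N"
      if "A \<in> Pow {..<2*n}" for A N
    proof -
      have "finite A" using that finite_subset by auto
      then have "oddprod n L A = (\<lambda>C. L ^ card (C \<inter> ygens n) * oddprod n 1 A C)"
        unfolding oddprod_eq_list using that by (intro ext oddprod_list_scale) auto
      then show ?thesis
        using theta_mul_pow_scale [of L N n "oddprod n 1 A" ?D] unfolding cardD \<kappa>_def by simp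
    qed
    let ?c = "\<lambda>A N k. (a gchoose k) * (-1) ^ N / fact (N - k) * (1 / L\<^sup>2) ^ k * L ^ (2 * n) * \<kappa> A N / pi ^ n"
    have g: "?g w = (\<Sum>A\<in>Pow {..<2*n}. \<Sum>N\<le>n. \<Sum>k\<le>N. ?c A N k * radial_deriv (N - k) (f A) x L w)" if w: "norm w = 1" for w
    proof -
      have radial_deriv: "(theta_mul n ^^ (k + j)) ((radD ^^ j) (shifted n f x L) w) ?D =
          (\<Sum>A\<in>Pow {..<2*n}. (1 / L\<^sup>2) ^ k * L ^ (2 * n) * \<kappa> A (k + j) * radial_deriv j (f A) x L w)" for k j
      proof -
        have "w \<noteq> 0" using w by auto
        then have "(radD ^^ j) (shifted n f x L) w =
            (\<lambda>C. \<Sum>A\<in>Pow {..<2*n}. (L ^ (2 * j) * radial_deriv j (f A) x L w) * oddprod n L A C)"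
          using radD_pow_shifted [OF f L, of w j x] w by (simp add: fun_eq_iff)
        then have "(theta_mul n ^^ (k + j)) ((radD ^^ j) (shifted n f x L) w) ?D =
            (\<Sum>A\<in>Pow {..<2*n}. (L ^ (2 * j) * radial_deriv j (f A) x L w) * (theta_mul n ^^ (k + j)) (oddprod n L A) ?D)"
          by (simp only: theta_mul_pow_sum)
        also have "\<dots> = (\<Sum>A\<in>Pow {..<2*n}. (1 / L\<^sup>2) ^ k * L ^ (2 * n) * \<kappa> A (k + j) * radial_deriv j (f A) x L w)"
        proof (intro sum.cong refl)
          fix A
          assume A: "A \<in> Pow {..<2 * n}"
          \<comment> \<open>The power from the radial derivatives is split so that homogeneity
            applies with N = k + j; what is left over is the factor 1/s^k of the Leibniz sum, s =
            L^2.\<close>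
          have "(1 / L\<^sup>2) ^ k * L ^ (2 * (k + j)) = L ^ (2 * j)"
            using L by (simp add: distrib_left power_add power_mult power_divide)
          then have "L ^ (2 * j) * (theta_mul n ^^ (k + j)) (oddprod n L A) ?D
              = (1 / L\<^sup>2) ^ k * (L ^ (2 * (k + j)) * (theta_mul n ^^ (k + j)) (oddprod n L A) ?D)"
            by (metis mult.assoc)
          then show "(L ^ (2 * j) * radial_deriv j (f A) x L w) * (theta_mul n ^^ (k + j)) (oddprod n L A) ?D =
             (1 / L\<^sup>2) ^ k * L ^ (2 * n) * \<kappa> A (k + j) * radial_deriv j (f A) x L w"
            unfolding \<kappa>_scale [OF A] by (simp add: mult_ac)
        qed
        finally show ?thesis .
      qed
      have "?g w = (\<Sum>k\<le>n. \<Sum>j\<le>n. (a gchoose k) * (-1) ^ (k + j) / fact j *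
          (\<Sum>A\<in>Pow {..<2*n}. (1 / L\<^sup>2) ^ k * L ^ (2 * n) * \<kappa> A (k + j) * radial_deriv j (f A) x L w)) / pi ^ n"
        using True gmul_sphere_weight_phi_sharp [OF finD w, of "CARD('m)" n "shifted n f x L"]
        unfolding radial_deriv berezin_eq a_def by simp
      also have "\<dots> = (\<Sum>k\<le>n. \<Sum>j\<le>n. \<Sum>A\<in>Pow {..<2*n}. (a gchoose k) * (-1) ^ (k + j) / fact j *
          (1 / L\<^sup>2) ^ k * L ^ (2 * n) * \<kappa> A (k + j) / pi ^ n * radial_deriv j (f A) x L w)"
        by (simp add: sum_distrib_left sum_divide_distrib mult_ac)
      \<comment> \<open>The weight and the Taylor operator are truncated separately at n. Terms with
        k + j > n vanish by degree, so the square can be summed along the diagonals N = k +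
        j.\<close>
      also have "\<dots> = (\<Sum>N\<le>n. \<Sum>k\<le>N. \<Sum>A\<in>Pow {..<2*n}. (a gchoose k) * (-1) ^ (k + (N - k)) / fact (N - k) *
          (1 / L\<^sup>2) ^ k * L ^ (2 * n) * \<kappa> A (k + (N - k)) / pi ^ n * radial_deriv (N - k) (f A) x L w)"
        by (rule sum_square_triangle) (simp add: \<kappa>_0)
      also have "\<dots> = (\<Sum>N\<le>n. \<Sum>k\<le>N. \<Sum>A\<in>Pow {..<2*n}. ?c A N k * radial_deriv (N - k) (f A) x L w)"
        by (intro sum.cong refl) simp
      also have "\<dots> = (\<Sum>N\<le>n. \<Sum>A\<in>Pow {..<2*n}. \<Sum>k\<le>N. ?c A N k * radial_deriv (N - k) (f A) x L w)"
        by (intro sum.cong refl sum.swap)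
      also have "\<dots> = (\<Sum>A\<in>Pow {..<2*n}. \<Sum>N\<le>n. \<Sum>k\<le>N. ?c A N k * radial_deriv (N - k) (f A) x L w)"
        by (rule sum.swap)
      finally show ?thesis .
    qed
    have cont: "continuous_on (sphere 0 1) (\<lambda>w. c * radial_deriv j (f A) x L w)" for c j A
      using smooth L by (intro continuous_intros radial_deriv_continuous_on_sphere)
    have "spherical_mean n f x L C = surface_int (\<lambda>w. \<Sum>A\<in>Pow {..<2*n}. \<Sum>N\<le>n. \<Sum>k\<le>N. ?c A N k * radial_deriv (N - k) (f A) x L w)"
      unfolding mean by (rule surface_int_cong) (rule g)
    also have "\<dots> = (\<Sum>A\<in>Pow {..<2*n}. surface_int (\<lambda>w. \<Sum>N\<le>n. \<Sum>k\<le>N. ?c A N k * radial_deriv (N - k) (f A) x L w))"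
      by (intro surface_int_sum continuous_on_sum cont) auto
    also have "\<dots> = (\<Sum>A\<in>Pow {..<2*n}. \<Sum>N\<le>n. surface_int (\<lambda>w. \<Sum>k\<le>N. ?c A N k * radial_deriv (N - k) (f A) x L w))"
      by (intro sum.cong refl surface_int_sum continuous_on_sum cont) auto
    also have "\<dots> = (\<Sum>A\<in>Pow {..<2*n}. \<Sum>N\<le>n. \<Sum>k\<le>N. ?c A N k * radial_mean (N - k) (f A) x L)"
      unfolding radial_mean_def surface_int_cmult [symmetric] by (intro sum.cong refl surface_int_sum cont) auto
    also have "\<dots> = (\<Sum>A\<in>Pow {..<2*n}. \<Sum>N\<le>n. mean_coeff n A N C * weighted_mean a n N (f A) x L)"
    proof (intro sum.cong refl)
      fix A N
      have "mean_coeff n A N C = (-1) ^ N / fact N * \<kappa> A N / pi ^ n"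
        using True by (simp add: mean_coeff_def \<kappa>_def)
      then show "(\<Sum>k\<le>N. ?c A N k * radial_mean (N - k) (f A) x L) = mean_coeff n A N C * weighted_mean a n N (f A) x L"
        by (simp add: weighted_mean_def sum_distrib_left mult_ac)
    qed
    finally show ?thesis
      by (simp only: a_def)
  qed
qed

text \<open>Inserting x-generators does not affect the extraction of the top y-coefficient, so the
  Berezin evaluation applies. Its factor N is absorbed by the factorial, and the alternating sign
  turns 4 into -4.\<close>

lemma pair_laplace_mean_coeff:
  assumes A: "A \<subseteq> {..<2 * n}"
  shows "pair_laplace n (\<lambda>k. {2 * k, Suc (2 * k)}) (mean_coeff n A N) C =
    (if N = 0 then 0 else - 4 * (real N - 1 - real n) * mean_coeff n A (N - 1) C)"
proof (cases "finite C \<and> C \<inter> ygens n = {}")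
  case False
  then have "mean_coeff n A N (C \<union> {2 * k, Suc (2 * k)}) = 0" for k N
    by (auto simp: mean_coeff_def)
  moreover have "mean_coeff n A (N - 1) C = 0"
    using False by (auto simp: mean_coeff_def)
  ultimately show ?thesis
    by (simp add: pair_laplace_def cong: if_cong)
next
  case True
  let ?X = "\<lambda>k. {2 * k, Suc (2 * k)}" and ?p = "oddprod n 1 A"
  let ?s = "(-1) ^ N / fact N / pi ^ n"
  have "(if ?X k \<inter> C = {} then mean_coeff n A N (C \<union> ?X k) else 0) =
      ?s * (if ?X k \<inter> (C \<union> ygens n) = {} then (theta_mul n ^^ N) ?p (C \<union> ygens n \<union> ?X k) else 0)" if "k < n" for k
  proof -
    have X: "?X k \<inter> ygens n = {}"
      using that by (auto simp: ygens_def)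
    then have "?X k \<inter> (C \<union> ygens n) = ?X k \<inter> C" "(C \<union> ?X k) \<inter> ygens n = {}"
        "C \<union> ?X k \<union> ygens n = C \<union> ygens n \<union> ?X k"
      using True by blast+
    then show ?thesis
      using True by (simp only: mean_coeff_def finite_Un finite_insert finite.emptyI if_True simp_thms if_cancel
          times_divide_eq_left times_divide_eq_right mult_1 split: if_split) simp
  qed
  then have "(\<Sum>k<n. if ?X k \<inter> C = {} then mean_coeff n A N (C \<union> ?X k) else 0) =
      (\<Sum>k<n. ?s * (if ?X k \<inter> (C \<union> ygens n) = {} then (theta_mul n ^^ N) ?p (C \<union> ygens n \<union> ?X k) else 0))"
    by (intro sum.cong refl) auto
  then have "pair_laplace n ?X (mean_coeff n A N) C = ?s * pair_laplace n ?X ((theta_mul n ^^ N) ?p) (C \<union> ygens n)"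
    by (simp only: pair_laplace_def sum_distrib_left [symmetric] mult.left_commute)
  also have "\<dots> = ?s * (4 * real N * (real N - 1 - real n) * (theta_mul n ^^ (N - 1)) ?p (C \<union> ygens n))"
    using True by (simp only: pair_laplace_berezin_coeff [OF A])
  also have "\<dots> = (if N = 0 then 0 else - 4 * (real N - 1 - real n) * mean_coeff n A (N - 1) C)"
  proof (cases N)
    case (Suc M)
    define p where "p = real N"
    have p: "p \<noteq> 0" "fact N = p * fact M" "(-1) ^ N = - ((-1::real) ^ M)" "N - 1 = M" "N \<noteq> 0"
      by (simp_all add: p_def Suc)
    show ?thesis
      using True p(1,5) unfolding p(2-4) p_def [symmetric] by (simp add: mean_coeff_def field_simps)
  qed simp
  finally show ?thesis .
qed

text \<open>Arranged so that adding (M - 1)/t times the first derivative removes the last term. No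
  multiple of \<open>weighted_mean a n N h x t\<close> then remains, because s^(n - a) = t^(2 - M)
  for t > 0 is radially harmonic in dimension M.\<close>

lemma weighted_mean_DERIV_t2:
  fixes h :: "real^'m \<Rightarrow> real"
  defines "a \<equiv> real CARD('m) / 2 - 1"
  assumes h: "smooth_fun h" and t: "t \<noteq> 0"
  shows "((\<lambda>t. 2 * t * ((real n - a) / t\<^sup>2 * weighted_mean a n N h x t + weighted_mean a n (Suc N) h x t)) has_real_derivative
    4 * (t\<^sup>2 * weighted_mean a n (N + 2) h x t + (1 + real n - a) * weighted_mean a n (N + 1) h x t)
    - (real CARD('m) - 2 * real n - 1) / t * (2 * t * ((real n - a) / t\<^sup>2 * weighted_mean a n N h x t + weighted_mean a n (Suc N) h x t))) (at t)"
proof -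
  define b where "b = real n - a"
  have m: "real CARD('m) - 2 * real n - 1 = 1 - 2 * b" and b1: "1 + real n - a = 1 + b"
    by (simp_all add: b_def a_def)
  have t1: "((\<lambda>t. 2 * t) has_real_derivative 2) (at t)" and t2: "((\<lambda>t. b / t\<^sup>2) has_real_derivative - 2 * b / t ^ 3) (at t)"
    using t by (auto intro!: derivative_eq_intros simp: field_simps power2_eq_square power3_eq_cube)
  have "((\<lambda>t. 2 * t * (b / t\<^sup>2 * weighted_mean a n N h x t + weighted_mean a n (Suc N) h x t)) has_real_derivative
     2 * (b / t\<^sup>2 * weighted_mean a n N h x t + weighted_mean a n (Suc N) h x t)
     + ((- 2 * b / t ^ 3) * weighted_mean a n N h x t + (2 * t * (b / t\<^sup>2 * weighted_mean a n N h x t + weighted_mean a n (Suc N) h x t)) * (b / t\<^sup>2)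
       + 2 * t * (b / t\<^sup>2 * weighted_mean a n (Suc N) h x t + weighted_mean a n (Suc (Suc N)) h x t)) * (2 * t)) (at t)"
    by (intro DERIV_mult DERIV_add t1 t2 weighted_mean_DERIV_t [OF h t, of a n, folded b_def])
  then show ?thesis
    unfolding m b1 b_def [symmetric]
    by (rule DERIV_cong) (use t in \<open>simp add: field_simps power2_eq_square power3_eq_cube\<close>)
qed

theorem theorem5p8:
  fixes f :: "nat set \<Rightarrow> real^'m \<Rightarrow> real" and n :: nat
    and x :: "real^'m" and L :: real
  assumes "superfun n f"
    and "L \<noteq> 0"
  shows "darboux_op n (spherical_mean n f) x L = gzero"
proof
  fix C
  define a where "a = real CARD('m) / 2 - 1"
  let ?I = "Pow {..<2 * n}" and ?X = "\<lambda>k. {2 * k, Suc (2 * k)}"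
  let ?c = "\<lambda>A N. mean_coeff n A N C"
  define W where "W = (\<lambda>A N. weighted_mean a n N (f A) x L)"
  have smooth: "smooth_fun (f A)" for A
    using assms(1) by (simp add: superfun_def)
  have mean: "spherical_mean n f z l D = (\<Sum>A\<in>?I. \<Sum>N\<le>n. mean_coeff n A N D * weighted_mean a n N (f A) z l)"
    if "l \<noteq> 0" for z l D
    unfolding a_def using spherical_mean_eq [OF assms(1) that] .

  \<comment> \<open>Stated for a general family g, because it is applied first to the coefficients
    of f and then to their partial derivatives.\<close>
  have px: "pderiv_x i (\<lambda>z. \<Sum>A\<in>?I. \<Sum>N\<le>n. ?c A N * weighted_mean a n N (g A) z L)
      = (\<lambda>z. \<Sum>A\<in>?I. \<Sum>N\<le>n. ?c A N * weighted_mean a n N (partial_deriv i (g A)) z L)"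
    if "i \<in> Basis" "\<And>A. smooth_fun (g A)" for i and g :: "nat set \<Rightarrow> real^'m \<Rightarrow> real"
  proof
    fix z
    have "((\<lambda>s. \<Sum>A\<in>?I. \<Sum>N\<le>n. ?c A N * weighted_mean a n N (g A) (z + s *\<^sub>R i) L) has_real_derivative
        (\<Sum>A\<in>?I. \<Sum>N\<le>n. ?c A N * weighted_mean a n N (partial_deriv i (g A)) (z + 0 *\<^sub>R i) L)) (at 0)"
      by (intro DERIV_sum DERIV_cmult weighted_mean_DERIV_x that assms(2))
    then show "pderiv_x i (\<lambda>z. \<Sum>A\<in>?I. \<Sum>N\<le>n. ?c A N * weighted_mean a n N (g A) z L) z
        = (\<Sum>A\<in>?I. \<Sum>N\<le>n. ?c A N * weighted_mean a n N (partial_deriv i (g A)) z L)"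
      by (simp add: pderiv_x_def DERIV_imp_deriv)
  qed
  have "(\<Sum>i\<in>Basis. pderiv_x i (pderiv_x i (\<lambda>z. spherical_mean n f z L C)) x)
      = (\<Sum>i\<in>Basis. \<Sum>A\<in>?I. \<Sum>N\<le>n. ?c A N * weighted_mean a n N (partial_deriv i (partial_deriv i (f A))) x L)"
    unfolding mean [OF assms(2)] by (intro sum.cong refl) (simp add: px smooth smooth_fun_partial)
  also have "\<dots> = (\<Sum>A\<in>?I. \<Sum>i\<in>Basis. \<Sum>N\<le>n. ?c A N * weighted_mean a n N (partial_deriv i (partial_deriv i (f A))) x L)"
    by (rule sum.swap)
  also have "\<dots> = (\<Sum>A\<in>?I. \<Sum>N\<le>n. \<Sum>i\<in>Basis. ?c A N * weighted_mean a n N (partial_deriv i (partial_deriv i (f A))) x L)"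
    by (intro sum.cong refl sum.swap)
  also have "\<dots> = (\<Sum>A\<in>?I. \<Sum>N\<le>n. ?c A N * (4 * (L\<^sup>2 * W A (N + 2) + (real N + 1 - a) * W A (N + 1))))"
    unfolding sum_distrib_left [symmetric] a_def W_def weighted_mean_laplace [OF smooth assms(2)] ..
  finally have even: "(\<Sum>i\<in>Basis. pderiv_x i (pderiv_x i (\<lambda>z. spherical_mean n f z L C)) x)
      = (\<Sum>A\<in>?I. \<Sum>N\<le>n. ?c A N * (4 * (L\<^sup>2 * W A (N + 2) + (real N + 1 - a) * W A (N + 1))))" .

  have "- 4 * (\<Sum>j<n. gderiv (2*j) (gderiv (2*j+1) (spherical_mean n f x L)) C)
      = pair_laplace n ?X (spherical_mean n f x L) C"
    using pair_laplace_gderiv [of n 0 "spherical_mean n f x L" C] by simp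
  also have "\<dots> = 4 * (\<Sum>k<n. \<Sum>A\<in>?I. \<Sum>N\<le>n. (if ?X k \<inter> C = {} then mean_coeff n A N (C \<union> ?X k) else 0) * W A N)"
    unfolding pair_laplace_def mean [OF assms(2)]
    by (intro arg_cong [where f = "times 4"] sum.cong refl) (auto simp: W_def)
  also have "\<dots> = 4 * (\<Sum>A\<in>?I. \<Sum>k<n. \<Sum>N\<le>n. (if ?X k \<inter> C = {} then mean_coeff n A N (C \<union> ?X k) else 0) * W A N)"
    by (subst sum.swap) (rule refl)
  also have "\<dots> = 4 * (\<Sum>A\<in>?I. \<Sum>N\<le>n. \<Sum>k<n. (if ?X k \<inter> C = {} then mean_coeff n A N (C \<union> ?X k) else 0) * W A N)"
    by (intro arg_cong [where f = "times 4"] sum.cong refl sum.swap)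
  also have "\<dots> = (\<Sum>A\<in>?I. \<Sum>N\<le>n. pair_laplace n ?X (mean_coeff n A N) C * W A N)"
    by (simp only: pair_laplace_def sum_distrib_left sum_distrib_right mult.assoc)
  also have "\<dots> = (\<Sum>A\<in>?I. \<Sum>N\<le>n. (if N = 0 then 0 else - 4 * (real N - 1 - real n) * ?c A (N - 1)) * W A N)"
    by (intro sum.cong refl) (simp only: pair_laplace_mean_coeff Pow_iff)
  finally have odd: "- 4 * (\<Sum>j<n. gderiv (2*j) (gderiv (2*j+1) (spherical_mean n f x L)) C) =
      (\<Sum>A\<in>?I. \<Sum>N\<le>n. (if N = 0 then 0 else - 4 * (real N - 1 - real n) * ?c A (N - 1)) * W A N)" .

  let ?D1 = "\<lambda>A N l. 2 * l * ((real n - a) / l\<^sup>2 * weighted_mean a n N (f A) x l + weighted_mean a n (Suc N) (f A) x l)"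
  \<comment> \<open>Proved at every nonzero l, since the formula is differentiated once
    more.\<close>
  have d1: "deriv (\<lambda>l. spherical_mean n f x l C) l = (\<Sum>A\<in>?I. \<Sum>N\<le>n. ?c A N * ?D1 A N l)" if "l \<noteq> 0" for l
  proof (rule DERIV_imp_deriv, rule has_real_derivative_cong_off_zero [OF _ that mean])
    show "((\<lambda>l. \<Sum>A\<in>?I. \<Sum>N\<le>n. ?c A N * weighted_mean a n N (f A) x l) has_real_derivative
        (\<Sum>A\<in>?I. \<Sum>N\<le>n. ?c A N * ?D1 A N l)) (at l)"
      by (intro DERIV_sum DERIV_cmult weighted_mean_DERIV_t smooth that)
  qed
  have d2: "deriv (deriv (\<lambda>l. spherical_mean n f x l C)) L = (\<Sum>A\<in>?I. \<Sum>N\<le>n. ?c A N *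
      (4 * (L\<^sup>2 * W A (N + 2) + (1 + real n - a) * W A (N + 1)) - (real CARD('m) - 2 * real n - 1) / L * ?D1 A N L))"
  proof (rule DERIV_imp_deriv, rule has_real_derivative_cong_off_zero [OF _ assms(2) d1])
    show "((\<lambda>l. \<Sum>A\<in>?I. \<Sum>N\<le>n. ?c A N * ?D1 A N l) has_real_derivative
        (\<Sum>A\<in>?I. \<Sum>N\<le>n. ?c A N * (4 * (L\<^sup>2 * W A (N + 2) + (1 + real n - a) * W A (N + 1))
          - (real CARD('m) - 2 * real n - 1) / L * ?D1 A N L))) (at L)"
      unfolding W_def a_def by (intro DERIV_sum DERIV_cmult weighted_mean_DERIV_t2 smooth assms(2))
  qed

  have "darboux_op n (spherical_mean n f) x L C =
      (\<Sum>A\<in>?I. \<Sum>N\<le>n. ?c A N * (4 * (L\<^sup>2 * W A (N + 2) + (real N + 1 - a) * W A (N + 1))))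
      + (\<Sum>A\<in>?I. \<Sum>N\<le>n. (if N = 0 then 0 else - 4 * (real N - 1 - real n) * ?c A (N - 1)) * W A N)
      - (\<Sum>A\<in>?I. \<Sum>N\<le>n. ?c A N * (4 * (L\<^sup>2 * W A (N + 2) + (1 + real n - a) * W A (N + 1))
          - (real CARD('m) - 2 * real n - 1) / L * ?D1 A N L))
      - (real CARD('m) - 2 * real n - 1) / L * (\<Sum>A\<in>?I. \<Sum>N\<le>n. ?c A N * ?D1 A N L)"
    unfolding darboux_op_def super_laplace_x_def even d1 [OF assms(2)] d2 odd [symmetric] by simp
  \<comment> \<open>The second order terms and those with M - 1 cancel; (N + 1 - a) - (1 + n - a)
    leaves N - n.\<close>
  also have "\<dots> = (\<Sum>A\<in>?I. \<Sum>N\<le>n. 4 * (real N - real n) * ?c A N * W A (N + 1)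
      + (if N = 0 then 0 else - 4 * (real N - 1 - real n) * ?c A (N - 1)) * W A N)"
    unfolding sum_distrib_left sum.distrib [symmetric] sum_subtractf [symmetric]
    by (intro sum.cong refl) (simp only: algebra_simps)
  also have "\<dots> = (\<Sum>A\<in>?I. 0)"
  proof (rule sum.cong [OF refl])
    fix A
    \<comment> \<open>The odd contribution at N + 1 is the negative of g N, so the sum up to k
      collapses to g k; at k = n the factor N - n vanishes.\<close>
    define g where "g = (\<lambda>N. 4 * (real N - real n) * ?c A N * W A (N + 1))"
    have "(\<Sum>N\<le>k. g N + (if N = 0 then 0 else - 4 * (real N - 1 - real n) * ?c A (N - 1)) * W A N) = g k" for k
      by (induction k) (simp_all add: g_def left_diff_distrib)
    moreover have "g n = 0"
      by (simp add: g_def)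
    ultimately show "(\<Sum>N\<le>n. 4 * (real N - real n) * ?c A N * W A (N + 1)
      + (if N = 0 then 0 else - 4 * (real N - 1 - real n) * ?c A (N - 1)) * W A N) = 0"
      unfolding g_def by metis
  qed
  finally show "darboux_op n (spherical_mean n f) x L C = gzero C"
    by (simp add: gzero_def)
qed

end
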